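(* Let $d$ be a positive integer. Let $G$ be the union of the graphs $G_1=(V_1,E_1)$ and $G_2=(V_2,E_2)$ with $|V_1\cap V_2|\le d+1$, and let $u,v\in V_1\cap V_2$ be a pair of vertices. If $\{u,v\}$ is $\mathcal{R}_d$-linked in both $G_1$ and $G_2$, then $\{u,v\}$ is globally linked in $G$ in $\mathbb{R}^d$.
   Context: Graphs are finite and simple, with a nonempty edge set; a pair of vertices consists of two distinct vertices. The union of $G_1,G_2$ is $(V_1\cup V_2,E_1\cup E_2)$. $G+uv$ is $G$ with the edge $uv$ added ($G+uv=G$ if $uv\in E(G)$). Let $G=(V,E)$. A framework in $\mathbb{C}^d$ (resp. $\mathbb{R}^d$) is a pair $(G,p)$ with $p:V\to\mathbb{C}^d$ (resp. $p:V\to\mathbb{R}^d$). It is generic if the $d|V|$ coordinates of $p$ do not satisfy any nonzero polynomial with rational coefficients. Put $m_{uv}(p)=\sum_{i=1}^d(p(u)_i-p(v)_i)^2$ and $m_{d,G}(p)=(m_{uv}(p))_{uv\in E}$. The generic rigidity matroid $\mathcal{R}_d(G)$ is the matroid on $E$ given by the rows of the Jacobian matrix of $m_{d,G}$ at any generic configuration $p$ in $\mathbb{C}^d$ (the result does not depend on $p$); $r_d(G)$ is its rank. A pair $\{u,v\}$ is $\mathcal{R}_d$-linked in $G$ if $r_d(G+uv)=r_d(G)$. A pair $\{u,v\}$ is globally linked in $G$ in $\mathbb{R}^d$ if for every generic framework $(G,p)$ in $\mathbb{R}^d$ and every framework $(G,q)$ in $\mathbb{R}^d$, $m_{d,G}(p)=m_{d,G}(q)$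 implies $m_{uv}(p)=m_{uv}(q)$. *)

theory Defs
  imports "HOL-Analysis.Analysis" "HOL-Library.Poly_Mapping"
begin

text \<open>A graph is a pair of a vertex set and a set of two-element subsets of it.\<close>

type_synonym 'a graph = "'a set \<times> 'a set set"

abbreviation verts :: "'a graph \<Rightarrow> 'a set" where "verts G \<equiv> fst G"
abbreviation edges :: "'a graph \<Rightarrow> 'a set set" where "edges G \<equiv> snd G"

definition is_graph :: "'a graph \<Rightarrow> bool" where
  "is_graph G \<longleftrightarrow>
     finite (verts G) \<and> (\<forall>e\<in>edges G. e \<subseteq> verts G \<and> card e = 2) \<and> edges G \<noteq> {}"

definition graph_union :: "'a graph \<Rightarrow> 'a graph \<Rightarrow> 'a graph" where
  "graph_union G1 G2 = (verts G1 \<union> verts G2, edges G1 \<union> edges G2)"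

definition add_edge :: "'a graph \<Rightarrow> 'a \<Rightarrow> 'a \<Rightarrow> 'a graph" where
  "add_edge G u v = (verts G, insert {u, v} (edges G))"

text \<open>
  A polynomial over the rationals in variables of type \<open>'x\<close> is a finitely supported map from
  monomials (finitely supported exponent functions) to coefficients.
\<close>

type_synonym 'x rat_mpoly = "('x \<Rightarrow>\<^sub>0 nat) \<Rightarrow>\<^sub>0 rat"

definition mpoly_vars :: "'x rat_mpoly \<Rightarrow> 'x set" where
  "mpoly_vars P = (\<Union>m\<in>Poly_Mapping.keys P. Poly_Mapping.keys m)"

definition mpoly_eval :: "('x \<Rightarrow> 'k::field_char_0) \<Rightarrow> 'x rat_mpoly \<Rightarrow> 'k" where
  "mpoly_eval x P =
     (\<Sum>m\<in>Poly_Mapping.keys P. of_rat (Poly_Mapping.lookup P m) *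
        (\<Prod>i\<in>Poly_Mapping.keys m. x i ^ Poly_Mapping.lookup m i))"

text \<open>
  The ambient dimension is \<open>CARD('d)\<close>. Configurations are total functions on the type of
  vertices; everything below depends only on their values on the vertex set \<open>V\<close>.
\<close>

definition generic :: "'a set \<Rightarrow> ('a \<Rightarrow> 'k::field_char_0 ^ 'd::finite) \<Rightarrow> bool" where
  "generic V p \<longleftrightarrow>
     (\<forall>P :: ('a \<times> 'd) rat_mpoly.
        P \<noteq> 0 \<and> mpoly_vars P \<subseteq> V \<times> UNIV \<longrightarrow> mpoly_eval (\<lambda>(w, i). p w $ i) P \<noteq> 0)"

definition sqlen :: "('a \<Rightarrow> 'k::comm_ring_1 ^ 'd::finite) \<Rightarrow> 'a \<Rightarrow> 'a \<Rightarrow> 'k" where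
  "sqlen p u v = (\<Sum>i\<in>UNIV. (p u $ i - p v $ i)\<^sup>2)"

definition edge_sqlen :: "('a \<Rightarrow> 'k::comm_ring_1 ^ 'd::finite) \<Rightarrow> 'a set \<Rightarrow> 'k" where
  "edge_sqlen p e = (THE c. \<exists>u v. e = {u, v} \<and> c = sqlen p u v)"

lemma sqlen_commute: "sqlen p u v = sqlen p v u"
  by (simp add: sqlen_def power2_commute)

lemma edge_sqlen_pair: "edge_sqlen p {u, v} = sqlen p u v"
  unfolding edge_sqlen_def
  by (rule the_equality) (auto simp: doubleton_eq_iff sqlen_commute)

text \<open>
  Entry of the Jacobian of the measurement map in the row of the edge \<open>e\<close> and the column of
  the coordinate \<open>(w, i)\<close>: the partial derivative of \<open>edge_sqlen _ e\<close> with respect to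
  the \<open>i\<close>-th coordinate of \<open>p w\<close>.
\<close>

definition edge_jacobian :: "('a \<Rightarrow> complex ^ 'd::finite) \<Rightarrow> 'a set \<Rightarrow> 'a \<times> 'd \<Rightarrow> complex" where
  "edge_jacobian p e = (\<lambda>(w, i).
     deriv (\<lambda>z. edge_sqlen (p(w := (\<chi> j. if j = i then z else p w $ j))) e) (p w $ i))"

definition rows_independent ::
    "'a set \<Rightarrow> ('a \<Rightarrow> complex ^ 'd::finite) \<Rightarrow> 'a set set \<Rightarrow> bool" where
  "rows_independent V p F \<longleftrightarrow>
     (\<forall>c :: 'a set \<Rightarrow> complex.
        (\<forall>x \<in> V \<times> UNIV. (\<Sum>e\<in>F. c e * edge_jacobian p e x) = 0) \<longrightarrow> (\<forall>e\<in>F. c e = 0))"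

text \<open>
  Generic configurations of a finite vertex set exist, and the matroid does not depend on which
  one is used, so the choice made by \<open>SOME\<close> is immaterial.
\<close>

definition rigidity_indep :: "'d::finite itself \<Rightarrow> 'a graph \<Rightarrow> 'a set set \<Rightarrow> bool" where
  "rigidity_indep D G F \<longleftrightarrow>
     F \<subseteq> edges G \<and>
     rows_independent (verts G) (SOME p :: 'a \<Rightarrow> complex ^ 'd. generic (verts G) p) F"

definition rigidity_rank :: "'d::finite itself \<Rightarrow> 'a graph \<Rightarrow> nat" where
  "rigidity_rank D G = Max (card ` {F. rigidity_indep D G F})"

definition rigidity_linked :: "'d::finite itself \<Rightarrow> 'a graph \<Rightarrow> 'a \<Rightarrow> 'a \<Rightarrow> bool" where
  "rigidity_linked D G u v \<longleftrightarrow> rigidity_rank D (add_edge G u v) = rigidity_rank D G"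

definition globally_linked :: "'d::finite itself \<Rightarrow> 'a graph \<Rightarrow> 'a \<Rightarrow> 'a \<Rightarrow> bool" where
  "globally_linked D G u v \<longleftrightarrow>
     (\<forall>(p :: 'a \<Rightarrow> real ^ 'd) (q :: 'a \<Rightarrow> real ^ 'd).
        generic (verts G) p \<and> (\<forall>e\<in>edges G. edge_sqlen p e = edge_sqlen q e) \<longrightarrow>
        sqlen p u v = sqlen q u v)"

end

theory Submission
  imports Defs "HOL-Computational_Algebra.Polynomial"
begin

text \<open>
  Let \<open>p\<close> be generic, let \<open>q\<close> have the same edge lengths, and write \<open>\<beta>\<close> and \<open>\<alpha>\<close> for the squared
  \<open>uv\<close>-lengths of \<open>p\<close> and \<open>q\<close>. Everything below is algebra over the complex numbers; the real
  statement follows by extension of scalars. If \<open>uv\<close> is an edge there is nothing to prove. Let \<open>m\<close> and \<open>m'\<close> be the squared edge lengths of \<open>p\<close>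
  and \<open>q\<close>, so that \<open>m = m'\<close> on the edges of \<open>G1\<close> and \<open>G2\<close>, while \<open>m\<close> is \<open>\<beta>\<close> and \<open>m'\<close> is \<open>\<alpha>\<close> at
  the pair \<open>uv\<close>.

  Because \<open>uv\<close> is linked in \<open>G1\<close>, \<open>\<beta>\<close> is algebraic over the field generated by the edge lengths of
  \<open>G1\<close> (\<open>linked_algebraic\<close>; linear dependence of differentials yields algebraic dependence, by
  extending derivations). As \<open>p\<close> is generic, every rational polynomial relation among the lengths of
  \<open>p\<close> is an identity and holds for \<open>q\<close> too, and therefore \<open>\<alpha>\<close> and \<open>\<beta>\<close> are conjugate over the edge
  lengths of \<open>G1\<close> (\<open>linked_conjugate\<close>). Let \<open>h\<close> be a minimal polynomial of \<open>\<beta>\<close>, with coefficients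
  lifted to polynomials in the edge lengths. Its gradient \<open>\<omega>\<close> at \<open>m\<close> is an equilibrium stress of
  \<open>G1 + uv\<close> at \<open>p\<close>, and its \<open>uv\<close>-entry is nonzero. Let \<open>\<omega>'\<close> be the gradient at \<open>m'\<close>, the conjugate
  of \<open>\<omega>\<close>. The point of the proof is that \<open>\<omega>'\<close> is an equilibrium stress of \<open>p\<close> as well:

  \<^item> At a vertex \<open>z\<close> of \<open>G1\<close> outside \<open>G2\<close>: since \<open>uv\<close> is linked in \<open>G2\<close>, \<open>\<alpha>\<close> is algebraic over the
    coordinates of \<open>p\<close> on \<open>G2\<close>, so it is killed by the derivation \<open>\<partial>/\<partial>z\<close>. Differentiating \<open>h m' = 0\<close>
    along \<open>z\<close> gives the equilibrium of \<open>\<omega>'\<close> at \<open>z\<close>.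

  \<^item> At a common vertex \<open>k\<close>: there are at most \<open>d + 1\<close> common vertices and \<open>p\<close> is generic, so they
    are affinely independent. Hence an affine function of \<open>p\<close>, which is in equilibrium for \<open>\<omega>\<close>, is
    \<open>1\<close> at \<open>k\<close> and \<open>0\<close> at the other common vertices. By conjugation such a function \<open>t\<close> also exists
    in equilibrium for \<open>\<omega>'\<close>. The stress matrix is symmetric; pairing \<open>t\<close> with the coordinates of
    \<open>p\<close>, for which the previous step leaves forces at common vertices only, shows that the force
    at \<open>k\<close> vanishes.

  An equilibrium stress of \<open>p\<close> has zero energy, so the sum of \<open>\<omega>' e * m e\<close> over the edges of
  \<open>G1 + uv\<close> is \<open>0\<close>. The same holds for \<open>\<omega>\<close>, and by conjugation the sum of \<open>\<omega>' e * m' e\<close> is \<open>0\<close>. These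
  two sums differ in the term for \<open>uv\<close> only, which leaves \<open>\<omega>' uv * (\<beta> - \<alpha>) = 0\<close>, where the first
  factor is conjugate to a nonzero number.
\<close>

section \<open>Polynomial functions with rational coefficients\<close>

text \<open>
  Functions replace formal polynomials: sums, products, substitution and partial derivatives of
  functions come for free, and genericity only asks whether a polynomial vanishes at a point.
\<close>

inductive_set ratpoly :: "'x set \<Rightarrow> (('x \<Rightarrow> complex) \<Rightarrow> complex) set" for S where
  const: "(\<lambda>x. of_rat c) \<in> ratpoly S"
| var: "i \<in> S \<Longrightarrow> (\<lambda>x. x i) \<in> ratpoly S"
| add: "f \<in> ratpoly S \<Longrightarrow> g \<in> ratpoly S \<Longrightarrow> (\<lambda>x. f x + g x) \<in> ratpoly S"
| mult: "f \<in> ratpoly S \<Longrightarrow> g \<in> ratpoly S \<Longrightarrow> (\<lambda>x. f x * g x) \<in> ratpoly S"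

lemma ratpoly_cong_on:
  assumes "f \<in> ratpoly S" "\<And>i. i \<in> S \<Longrightarrow> x i = y i"
  shows "f x = f y"
  using assms by induction auto

lemma ratpoly_mono: "f \<in> ratpoly S \<Longrightarrow> S \<subseteq> T \<Longrightarrow> f \<in> ratpoly T"
  by (induction rule: ratpoly.induct) (auto intro: ratpoly.intros)

lemma ratpoly_compose:
  assumes "f \<in> ratpoly S" "\<And>e. e \<in> S \<Longrightarrow> (\<lambda>x. G x e) \<in> ratpoly T"
  shows "(\<lambda>x. f (G x)) \<in> ratpoly T"
  using assms by induction (auto intro: ratpoly.intros)

lemma ratpoly_zero: "(\<lambda>x. 0) \<in> ratpoly S"
  using ratpoly.const[of 0] by simp

lemma ratpoly_one: "(\<lambda>x. 1) \<in> ratpoly S"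
  using ratpoly.const[of 1] by simp

lemma ratpoly_uminus: "f \<in> ratpoly S \<Longrightarrow> (\<lambda>x. - f x) \<in> ratpoly S"
  using ratpoly.mult[OF ratpoly.const[of "-1"], of f S] by simp

lemma ratpoly_diff: "f \<in> ratpoly S \<Longrightarrow> g \<in> ratpoly S \<Longrightarrow> (\<lambda>x. f x - g x) \<in> ratpoly S"
  using ratpoly.add[OF _ ratpoly_uminus] by fastforce

lemma ratpoly_power: "f \<in> ratpoly S \<Longrightarrow> (\<lambda>x. f x ^ n) \<in> ratpoly S"
  by (induction n) (auto intro: ratpoly_one ratpoly.mult)

lemma ratpoly_sum:
  "(\<And>i. i \<in> I \<Longrightarrow> f i \<in> ratpoly S) \<Longrightarrow> (\<lambda>x. \<Sum>i\<in>I. f i x) \<in> ratpoly S"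
  by (induction I rule: infinite_finite_induct) (auto intro: ratpoly_zero ratpoly.add)

definition monomial_val :: "('x \<Rightarrow> complex) \<Rightarrow> ('x \<Rightarrow>\<^sub>0 nat) \<Rightarrow> complex" where
  "monomial_val x m = (\<Prod>i\<in>Poly_Mapping.keys m. x i ^ Poly_Mapping.lookup m i)"

lemma monomial_val_superset:
  assumes "finite B" "Poly_Mapping.keys m \<subseteq> B"
  shows "monomial_val x m = (\<Prod>i\<in>B. x i ^ Poly_Mapping.lookup m i)"
  unfolding monomial_val_def
  by (rule prod.mono_neutral_left) (use assms in \<open>auto simp: in_keys_iff\<close>)

lemma monomial_val_add: "monomial_val x (m + n) = monomial_val x m * monomial_val x n"
proof -
  let ?B = "Poly_Mapping.keys m \<union> Poly_Mapping.keys n"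
  have "monomial_val x (m + n) = (\<Prod>i\<in>?B. x i ^ Poly_Mapping.lookup (m + n) i)"
    by (rule monomial_val_superset) (use Poly_Mapping.keys_add[of m n] in auto)
  then show ?thesis
    by (simp add: monomial_val_superset[of ?B] lookup_add power_add prod.distrib)
qed

definition mpoly_function :: "'x set \<Rightarrow> (('x \<Rightarrow> complex) \<Rightarrow> complex) \<Rightarrow> bool" where
  "mpoly_function S f \<longleftrightarrow> (\<exists>P. mpoly_vars P \<subseteq> S \<and> (\<forall>x. mpoly_eval x P = f x))"

lemma mpoly_eval_superset:
  assumes "finite B" "Poly_Mapping.keys P \<subseteq> B"
  shows "mpoly_eval x P = (\<Sum>m\<in>B. of_rat (Poly_Mapping.lookup P m) * monomial_val x m)"
  unfolding mpoly_eval_def monomial_val_def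
  by (rule sum.mono_neutral_left) (use assms in \<open>auto simp: in_keys_iff\<close>)

lemma mpoly_function_add:
  assumes "mpoly_function S f" "mpoly_function S g"
  shows "mpoly_function S (\<lambda>x. f x + g x)"
proof -
  obtain P Q where P: "mpoly_vars P \<subseteq> S" "\<And>x. mpoly_eval x P = f x"
    and Q: "mpoly_vars Q \<subseteq> S" "\<And>x. mpoly_eval x Q = g x"
    using assms unfolding mpoly_function_def by blast
  let ?B = "Poly_Mapping.keys P \<union> Poly_Mapping.keys Q"
  have sub: "Poly_Mapping.keys (P + Q) \<subseteq> ?B" by (rule Poly_Mapping.keys_add)
  have "mpoly_eval x (P + Q) = f x + g x" for x
  proof -
    have "mpoly_eval x (P + Q) = (\<Sum>m\<in>?B. of_rat (Poly_Mapping.lookup P m) * monomial_val x m)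
        + (\<Sum>m\<in>?B. of_rat (Poly_Mapping.lookup Q m) * monomial_val x m)"
      by (simp add: mpoly_eval_superset[OF _ sub] lookup_add of_rat_add
          distrib_right sum.distrib)
    also have "\<dots> = mpoly_eval x P + mpoly_eval x Q"
      by (simp add: mpoly_eval_superset[of ?B])
    finally show ?thesis by (simp add: P Q)
  qed
  moreover have "mpoly_vars (P + Q) \<subseteq> S"
    using sub P(1) Q(1) unfolding mpoly_vars_def by blast
  ultimately show ?thesis unfolding mpoly_function_def by blast
qed

lemma mpoly_function_monomial:
  assumes "Poly_Mapping.keys m \<subseteq> S"
  shows "mpoly_function S (\<lambda>x. of_rat c * monomial_val x m)"
proof -
  have "mpoly_vars (Poly_Mapping.single m c) \<subseteq> S"
    using assms by (auto simp: mpoly_vars_def split: if_splits)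
  moreover have "mpoly_eval x (Poly_Mapping.single m c) = of_rat c * monomial_val x m" for x
    by (subst mpoly_eval_superset[of "{m}"]) auto
  ultimately show ?thesis unfolding mpoly_function_def by blast
qed

lemma mpoly_function_sum:
  "finite I \<Longrightarrow> (\<And>i. i \<in> I \<Longrightarrow> mpoly_function S (f i)) \<Longrightarrow> mpoly_function S (\<lambda>x. \<Sum>i\<in>I. f i x)"
proof (induction I rule: finite_induct)
  case empty
  show ?case using mpoly_function_monomial[of 0 S 0] by simp
next
  case (insert i I)
  then show ?case using mpoly_function_add[of S "f i" "\<lambda>x. \<Sum>i\<in>I. f i x"] by simp
qed

text \<open>
  Multiplying two formal polynomials is avoided: the product of the values is a finite sum of
  monomials, and finite sums of monomials are already covered.
\<close>

lemma mpoly_function_mult: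
  assumes "mpoly_function S f" "mpoly_function S g"
  shows "mpoly_function S (\<lambda>x. f x * g x)"
proof -
  obtain P Q where P: "mpoly_vars P \<subseteq> S" "\<And>x. mpoly_eval x P = f x"
    and Q: "mpoly_vars Q \<subseteq> S" "\<And>x. mpoly_eval x Q = g x"
    using assms unfolding mpoly_function_def by blast
  let ?l = "Poly_Mapping.lookup"
  have eq: "f x * g x = (\<Sum>m\<in>Poly_Mapping.keys P. \<Sum>n\<in>Poly_Mapping.keys Q.
      of_rat (?l P m * ?l Q n) * monomial_val x (m + n))" for x
    unfolding P(2)[symmetric] Q(2)[symmetric]
    by (simp add: mpoly_eval_superset[OF _ subset_refl] sum_product of_rat_mult
        monomial_val_add algebra_simps)
  have "Poly_Mapping.keys (m + n) \<subseteq> S"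
    if "m \<in> Poly_Mapping.keys P" "n \<in> Poly_Mapping.keys Q" for m n
    using that P(1) Q(1) Poly_Mapping.keys_add[of m n] unfolding mpoly_vars_def by blast
  then show ?thesis
    unfolding eq by (intro mpoly_function_sum mpoly_function_monomial) auto
qed

lemma ratpoly_imp_mpoly_function:
  assumes "f \<in> ratpoly S"
  shows "mpoly_function S f"
  using assms
proof induction
  case (const c)
  show ?case using mpoly_function_monomial[of 0 S c] by (simp add: monomial_val_def)
next
  case (var i)
  show ?case
    using mpoly_function_monomial[of "Poly_Mapping.single i 1" S 1] var
    by (simp add: monomial_val_def)
qed (auto intro: mpoly_function_add mpoly_function_mult)

definition coords :: "('a \<Rightarrow> complex ^ 'd::finite) \<Rightarrow> 'a \<times> 'd \<Rightarrow> complex" where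
  "coords p = (\<lambda>(w, i). p w $ i)"

definition config_of :: "('a \<times> 'd::finite \<Rightarrow> complex) \<Rightarrow> 'a \<Rightarrow> complex ^ 'd" where
  "config_of x = (\<lambda>w. \<chi> i. x (w, i))"

lemma coords_apply [simp]: "coords p (w, i) = p w $ i"
  by (simp add: coords_def)

lemma config_of_coords [simp]: "config_of (coords p) = p"
  by (simp add: config_of_def fun_eq_iff vec_eq_iff)

lemma config_of_nth [simp]: "config_of x w $ i = x (w, i)"
  by (simp add: config_of_def)

text \<open>
  The form in which genericity is used: a rational polynomial relation between the coordinates of a
  generic configuration is an identity, hence holds for all configurations.
\<close>

lemma generic_ratpoly_identity:
  assumes "generic V p" "f \<in> ratpoly (V \<times> UNIV)" "f (coords p) = 0"
  shows "f x = 0"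
proof -
  obtain P where P: "mpoly_vars P \<subseteq> V \<times> UNIV" "\<And>x. mpoly_eval x P = f x"
    using ratpoly_imp_mpoly_function[OF assms(2)] unfolding mpoly_function_def by blast
  have "P = 0"
    using assms(1,3) P unfolding generic_def coords_def by metis
  then show ?thesis using P(2)[of x] by (simp add: mpoly_eval_def)
qed

lemma generic_subset: "generic V p \<Longrightarrow> W \<subseteq> V \<Longrightarrow> generic W p"
  unfolding generic_def by blast

lemma generic_of_real:
  fixes p :: "'a \<Rightarrow> real ^ 'd::finite"
  assumes "generic V p"
  shows "generic V (\<lambda>w. \<chi> i. complex_of_real (p w $ i))"
proof -
  have "mpoly_eval (\<lambda>(w, i). complex_of_real (p w $ i)) P
      = complex_of_real (mpoly_eval (\<lambda>(w, i). p w $ i) P)" for P :: "('a \<times> 'd) rat_mpoly"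
  proof -
    have "complex_of_real (of_rat c) = of_rat c" for c
      by (cases c) (simp add: of_rat_rat)
    then show ?thesis
      by (simp add: mpoly_eval_def case_prod_unfold)
  qed
  then show ?thesis using assms unfolding generic_def by (simp add: case_prod_unfold)
qed

lemma edge_sqlen_ratpoly:
  assumes "e \<subseteq> V" "card e = 2"
  shows "(\<lambda>x. edge_sqlen (config_of x) e) \<in> ratpoly (V \<times> UNIV)"
proof -
  obtain a b where e: "e = {a, b}" using assms(2) by (auto simp: card_2_iff)
  show ?thesis
    unfolding e edge_sqlen_pair sqlen_def config_of_nth
    by (intro ratpoly_sum ratpoly_power ratpoly_diff ratpoly.var) (use assms(1) e in auto)
qed

lemma generic_edge_identity:
  fixes p q :: "'a \<Rightarrow> complex ^ 'd::finite"
  assumes "generic V p" "f \<in> ratpoly E" "\<And>e. e \<in> E \<Longrightarrow> e \<subseteq> V \<and> card e = 2"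
    and "f (edge_sqlen p) = 0"
  shows "f (edge_sqlen q) = 0"
proof -
  have "(\<lambda>x. f (edge_sqlen (config_of x))) \<in> ratpoly (V \<times> UNIV)"
    by (rule ratpoly_compose[OF assms(2)]) (use assms(3) edge_sqlen_ratpoly in blast)
  from generic_ratpoly_identity[OF assms(1) this, of "coords q"] assms(4) show ?thesis
    by simp
qed

section \<open>Derivations on subrings of the complex numbers\<close>

text \<open>
  Containing the rationals makes these rings stable under the operations needed for polynomials,
  without having to speak of subfields; inverses are never taken.
\<close>

definition rat_subring :: "complex set \<Rightarrow> bool" where
  "rat_subring K \<longleftrightarrow> (\<forall>c. of_rat c \<in> K) \<and> (\<forall>a\<in>K. \<forall>b\<in>K. a + b \<in> K \<and> a * b \<in> K)"

definition derivation :: "complex set \<Rightarrow> (complex \<Rightarrow> complex) \<Rightarrow> bool" where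
  "derivation K D \<longleftrightarrow> rat_subring K \<and>
     (\<forall>a\<in>K. \<forall>b\<in>K. D (a + b) = D a + D b \<and> D (a * b) = D a * b + a * D b)"

definition derivation_extends ::
    "complex set \<Rightarrow> (complex \<Rightarrow> complex) \<Rightarrow> complex set \<Rightarrow> (complex \<Rightarrow> complex) \<Rightarrow> bool" where
  "derivation_extends K D K' D' \<longleftrightarrow> derivation K' D' \<and> K \<subseteq> K' \<and> (\<forall>x\<in>K. D' x = D x)"

definition polys_over :: "complex set \<Rightarrow> complex poly set" where
  "polys_over K = {f. \<forall>i. coeff f i \<in> K}"

definition adjoin :: "complex set \<Rightarrow> complex \<Rightarrow> complex set" where
  "adjoin K a = (\<lambda>f. poly f a) ` polys_over K"

definition algebraic_over :: "complex set \<Rightarrow> complex \<Rightarrow> bool" where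
  "algebraic_over K a \<longleftrightarrow> (\<exists>f\<in>polys_over K. f \<noteq> 0 \<and> poly f a = 0)"

lemma rat_subring_closed:
  assumes "rat_subring K"
  shows "of_rat c \<in> K" "0 \<in> K" "1 \<in> K" "a \<in> K \<Longrightarrow> b \<in> K \<Longrightarrow> a + b \<in> K"
    "a \<in> K \<Longrightarrow> b \<in> K \<Longrightarrow> a * b \<in> K" "a \<in> K \<Longrightarrow> - a \<in> K"
    "a \<in> K \<Longrightarrow> b \<in> K \<Longrightarrow> a - b \<in> K" "of_nat n \<in> K" "a \<in> K \<Longrightarrow> a ^ n \<in> K"
proof -
  have r: "of_rat c \<in> K" for c using assms by (simp add: rat_subring_def)
  have m: "a \<in> K \<Longrightarrow> b \<in> K \<Longrightarrow> a * b \<in> K" for a b using assms by (simp add: rat_subring_def)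
  have p: "a \<in> K \<Longrightarrow> b \<in> K \<Longrightarrow> a + b \<in> K" for a b using assms by (simp add: rat_subring_def)
  have n: "a \<in> K \<Longrightarrow> - a \<in> K" for a using m[OF r[of "-1"], of a] by simp
  show "of_rat c \<in> K" "0 \<in> K" "1 \<in> K" "of_nat n \<in> K" 
    using r[of c] r[of 0] r[of 1] r[of "of_nat n"] by simp_all
  show "a \<in> K \<Longrightarrow> b \<in> K \<Longrightarrow> a + b \<in> K" "a \<in> K \<Longrightarrow> b \<in> K \<Longrightarrow> a * b \<in> K" "a \<in> K \<Longrightarrow> - a \<in> K"
    by (fact p m n)+
  show "a \<in> K \<Longrightarrow> b \<in> K \<Longrightarrow> a - b \<in> K" using p[OF _ n, of a b] by simp
  show "a \<in> K \<Longrightarrow> a ^ n \<in> K"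
    by (induction n) (use r[of 1] m in auto)
qed

lemma rat_subring_sum:
  "rat_subring K \<Longrightarrow> (\<And>i. i \<in> I \<Longrightarrow> f i \<in> K) \<Longrightarrow> sum f I \<in> K"
  by (induction I rule: infinite_finite_induct) (auto simp: rat_subring_closed)

lemma derivation_simps:
  assumes "derivation K D"
  shows "D 0 = 0" "D 1 = 0" "a \<in> K \<Longrightarrow> b \<in> K \<Longrightarrow> D (a + b) = D a + D b"
    "a \<in> K \<Longrightarrow> b \<in> K \<Longrightarrow> D (a * b) = D a * b + a * D b"
    "a \<in> K \<Longrightarrow> D (- a) = - D a"
    "a \<in> K \<Longrightarrow> b \<in> K \<Longrightarrow> D (a - b) = D a - D b" "D (of_rat c) = 0"
proof -
  have K: "rat_subring K" using assms by (simp add: derivation_def)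
  note c = rat_subring_closed[OF K]
  have add: "D (a + b) = D a + D b" if "a \<in> K" "b \<in> K" for a b
    using assms that by (simp add: derivation_def)
  have mult: "D (a * b) = D a * b + a * D b" if "a \<in> K" "b \<in> K" for a b
    using assms that by (simp add: derivation_def)
  show "a \<in> K \<Longrightarrow> b \<in> K \<Longrightarrow> D (a + b) = D a + D b"
    "a \<in> K \<Longrightarrow> b \<in> K \<Longrightarrow> D (a * b) = D a * b + a * D b" by (fact add mult)+
  show z: "D 0 = 0" using add[of 0 0] c(2) by simp
  show o: "D 1 = 0" using mult[of 1 1] c(3) by simp
  have neg: "D (- a) = - D a" if "a \<in> K" for a
    using add[of a "- a"] z that c(6)[of a] by (simp add: eq_neg_iff_add_eq_0 add.commute)
  show "a \<in> K \<Longrightarrow> D (- a) = - D a" by (fact neg)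
  show "a \<in> K \<Longrightarrow> b \<in> K \<Longrightarrow> D (a - b) = D a - D b"
    using add[of a "- b"] neg[of b] c(6)[of b] by simp
  have nat: "D (of_nat n) = 0" for n
    by (induction n) (use z o add c in \<open>auto simp: c\<close>)
  have int: "D (of_int n) = 0" for n
    by (cases n rule: int_cases2) (use nat neg c(8) in auto)
  show "D (of_rat c) = 0"
  proof (cases c)
    case (Fract a b)
    then have eq: "of_int b * of_rat c = (of_int a :: complex)"
      by (simp add: of_rat_rat)
    have "of_int b \<in> K" using c(1)[of "of_int b"] by simp
    with mult[of "of_int b" "of_rat c"] c(1)[of c] eq int Fract show ?thesis by auto
  qed
qed

lemma derivation_sum:
  assumes "derivation K D" "\<And>i. i \<in> I \<Longrightarrow> f i \<in> K"
  shows "D (sum f I) = (\<Sum>i\<in>I. D (f i))"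
proof -
  have K: "rat_subring K" using assms(1) by (simp add: derivation_def)
  show ?thesis
    using assms(2)
    by (induction I rule: infinite_finite_induct)
      (auto simp: derivation_simps[OF assms(1)] rat_subring_sum[OF K])
qed


lemma polys_over_pCons: "pCons c f \<in> polys_over K \<longleftrightarrow> c \<in> K \<and> f \<in> polys_over K"
  unfolding polys_over_def by (auto simp: coeff_pCons split: nat.splits)

lemma polys_over_closed:
  assumes "rat_subring K"
  shows "0 \<in> polys_over K" "c \<in> K \<Longrightarrow> [:c:] \<in> polys_over K"
    "f \<in> polys_over K \<Longrightarrow> g \<in> polys_over K \<Longrightarrow> f + g \<in> polys_over K"
    "f \<in> polys_over K \<Longrightarrow> g \<in> polys_over K \<Longrightarrow> f - g \<in> polys_over K"
    "f \<in> polys_over K \<Longrightarrow> g \<in> polys_over K \<Longrightarrow> f * g \<in> polys_over K"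
    "c \<in> K \<Longrightarrow> monom c n \<in> polys_over K"
    "f \<in> polys_over K \<Longrightarrow> pderiv f \<in> polys_over K"
proof -
  note c = rat_subring_closed[OF assms]
  show "0 \<in> polys_over K" "c \<in> K \<Longrightarrow> [:c:] \<in> polys_over K"
    "f \<in> polys_over K \<Longrightarrow> g \<in> polys_over K \<Longrightarrow> f + g \<in> polys_over K"
    "f \<in> polys_over K \<Longrightarrow> g \<in> polys_over K \<Longrightarrow> f - g \<in> polys_over K"
    "c \<in> K \<Longrightarrow> monom c n \<in> polys_over K"
    using c by (auto simp: polys_over_def coeff_pCons split: nat.splits)
  show "f \<in> polys_over K \<Longrightarrow> g \<in> polys_over K \<Longrightarrow> f * g \<in> polys_over K"
    unfolding polys_over_def mem_Collect_eq coeff_mult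
    by (intro allI rat_subring_sum[OF assms] c) auto
  show "pderiv f \<in> polys_over K" if "f \<in> polys_over K"
    unfolding polys_over_def mem_Collect_eq coeff_pderiv
    by (intro allI c(5)[OF c(8)]) (use that in \<open>simp add: polys_over_def\<close>)
qed

lemma poly_in_subring:
  "rat_subring K \<Longrightarrow> f \<in> polys_over K \<Longrightarrow> a \<in> K \<Longrightarrow> poly f a \<in> K"
  by (induction f) (auto simp: polys_over_pCons rat_subring_closed)

text \<open>
  If \<open>D\<close> is to be extended to \<open>a\<close> with \<open>D a = a'\<close>, this is the value that the Leibniz rule forces at
  \<open>poly f a\<close>.
\<close>

definition derivation_eval :: "(complex \<Rightarrow> complex) \<Rightarrow> complex \<Rightarrow> complex \<Rightarrow> complex poly \<Rightarrow> complex" where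
  "derivation_eval D a a' f = poly (map_poly D f) a + poly (pderiv f) a * a'"

lemma derivation_eval_add:
  assumes "derivation K D" "f \<in> polys_over K" "g \<in> polys_over K"
  shows "derivation_eval D a a' (f + g) = derivation_eval D a a' f + derivation_eval D a a' g"
proof -
  have "map_poly D (f + g) = map_poly D f + map_poly D g"
    by (rule poly_eqI)
      (use assms in \<open>simp add: coeff_map_poly derivation_simps[OF assms(1)] polys_over_def\<close>)
  then show ?thesis by (simp add: derivation_eval_def pderiv_add algebra_simps)
qed

lemma derivation_eval_diff:
  assumes "derivation K D" "f \<in> polys_over K" "g \<in> polys_over K"
  shows "derivation_eval D a a' (f - g) = derivation_eval D a a' f - derivation_eval D a a' g"
proof -
  have "map_poly D (f - g) = map_poly D f - map_poly D g"
    by (rule poly_eqI)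
      (use assms in \<open>simp add: coeff_map_poly derivation_simps[OF assms(1)] polys_over_def\<close>)
  then show ?thesis by (simp only: derivation_eval_def pderiv_diff poly_diff) (simp add: algebra_simps)
qed

lemma derivation_eval_mult:
  assumes "derivation K D" "f \<in> polys_over K" "g \<in> polys_over K"
  shows "derivation_eval D a a' (f * g)
    = derivation_eval D a a' f * poly g a + poly f a * derivation_eval D a a' g"
proof -
  have K: "rat_subring K" using assms(1) by (simp add: derivation_def)
  have "map_poly D (f * g) = map_poly D f * g + f * map_poly D g"
  proof (rule poly_eqI)
    fix n
    have c: "coeff f i \<in> K" "coeff g i \<in> K" for i
      using assms by (auto simp: polys_over_def)
    show "coeff (map_poly D (f * g)) n = coeff (map_poly D f * g + f * map_poly D g) n"
      by (simp add: coeff_map_poly derivation_simps[OF assms(1)] coeff_mult c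
          derivation_sum[OF assms(1)] rat_subring_closed[OF K] sum.distrib)
  qed
  then show ?thesis by (simp add: derivation_eval_def pderiv_mult algebra_simps)
qed

lemma derivation_eval_const:
  assumes "derivation K D"
  shows "derivation_eval D a a' [:c:] = D c"
  by (simp add: derivation_eval_def map_poly_pCons derivation_simps(1)[OF assms])

lemma derivation_poly:
  assumes "derivation K D" "f \<in> polys_over K" "a \<in> K"
  shows "D (poly f a) = derivation_eval D a (D a) f"
  using assms(2)
proof (induction f)
  case 0
  show ?case by (simp add: derivation_eval_def derivation_simps[OF assms(1)])
next
  case (pCons c f)
  have K: "rat_subring K" using assms(1) by (simp add: derivation_def)
  have cf: "c \<in> K" "f \<in> polys_over K" using pCons.prems by (auto simp: polys_over_pCons)
  have "poly f a \<in> K" by (rule poly_in_subring[OF K cf(2) assms(3)])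
  then have "D (poly (pCons c f) a) = D c + (D a * poly f a + a * derivation_eval D a (D a) f)"
    using cf assms(3) pCons.IH
    by (simp add: derivation_simps[OF assms(1)] rat_subring_closed[OF K])
  also have "\<dots> = derivation_eval D a (D a) (pCons c f)"
    by (simp add: derivation_eval_def map_poly_pCons derivation_simps(1)[OF assms(1)] pderiv_pCons algebra_simps)
  finally show ?case .
qed

text \<open>
  The forced values are consistent as soon as two representations of the same number get the same
  value, which is the hypothesis \<open>compat\<close>.
\<close>

lemma adjoin_derivation:
  assumes D: "derivation K D"
    and compat: "\<And>f. f \<in> polys_over K \<Longrightarrow> poly f a = 0 \<Longrightarrow> derivation_eval D a a' f = 0"
  shows "\<exists>K' D'. derivation_extends K D K' D' \<and> a \<in> K' \<and> D' a = a'"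
proof -
  have K: "rat_subring K" using D by (simp add: derivation_def)
  note pc = polys_over_closed[OF K]
  define D' where "D' y = derivation_eval D a a' (SOME f. f \<in> polys_over K \<and> poly f a = y)" for y
  have D'_poly: "D' (poly f a) = derivation_eval D a a' f" if f: "f \<in> polys_over K" for f
  proof -
    define g where "g = (SOME g. g \<in> polys_over K \<and> poly g a = poly f a)"
    have g: "g \<in> polys_over K \<and> poly g a = poly f a"
      unfolding g_def by (rule someI[of _ f]) (use f in simp)
    then have "derivation_eval D a a' (g - f) = 0"
      by (intro compat pc f) auto
    with g f show ?thesis
      by (simp add: D'_def derivation_eval_diff[OF D] flip: g_def)
  qed
  have const: "[:c:] \<in> polys_over K" if "c \<in> K" for c using pc(2) that .
  have X: "[:0, 1:] \<in> polys_over K"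
    by (simp add: polys_over_pCons pc rat_subring_closed[OF K])
  have sub: "K \<subseteq> adjoin K a"
    unfolding adjoin_def by (force intro!: const)
  have mem: "poly f a \<in> adjoin K a" if "f \<in> polys_over K" for f
    using that by (simp add: adjoin_def)
  have "derivation (adjoin K a) D'"
    unfolding derivation_def rat_subring_def
  proof (intro conjI ballI allI)
    show "of_rat c \<in> adjoin K a" for c
      using sub rat_subring_closed(1)[OF K] by blast
    fix x y assume "x \<in> adjoin K a" "y \<in> adjoin K a"
    then obtain f g where fg: "f \<in> polys_over K" "x = poly f a" "g \<in> polys_over K" "y = poly g a"
      by (auto simp: adjoin_def)
    have eqs: "x + y = poly (f + g) a" "x * y = poly (f * g) a" using fg by simp_all
    show "x + y \<in> adjoin K a" "x * y \<in> adjoin K a"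
      unfolding eqs by (intro mem pc fg)+
    show "D' (x + y) = D' x + D' y" "D' (x * y) = D' x * y + x * D' y"
      unfolding eqs unfolding fg
      by (simp_all only: D'_poly pc fg derivation_eval_add[OF D] derivation_eval_mult[OF D])
  qed
  moreover have "D' x = D x" if "x \<in> K" for x
    using D'_poly[OF const[OF that]] derivation_eval_const[OF D] by simp
  moreover have "D' a = a'"
    using D'_poly[OF X] rat_subring_closed[OF K]
    by (simp add: derivation_eval_def map_poly_pCons derivation_simps(1)[OF D] derivation_simps[OF D] pderiv_pCons)
  moreover have "a \<in> adjoin K a" using mem[OF X] by simp
  ultimately have "derivation_extends K D (adjoin K a) D' \<and> a \<in> adjoin K a \<and> D' a = a'"
    using sub by (simp add: derivation_extends_def)
  then show ?thesis by blast
qed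

text \<open>
  Minimality of the degree gives separability (the derivative is a nonzero polynomial of smaller
  degree, as the characteristic is \<open>0\<close>) and a nonzero constant term (otherwise divide by the
  variable).
\<close>

lemma minimal_polynomial:
  assumes K: "rat_subring K" and "algebraic_over K a"
  shows "\<exists>g\<in>polys_over K. g \<noteq> 0 \<and> poly g a = 0 \<and> poly (pderiv g) a \<noteq> 0 \<and>
    (a \<noteq> 0 \<longrightarrow> coeff g 0 \<noteq> 0) \<and>
    (\<forall>f\<in>polys_over K. f \<noteq> 0 \<longrightarrow> poly f a = 0 \<longrightarrow> degree g \<le> degree f)"
proof -
  define P where "P f \<longleftrightarrow> f \<in> polys_over K \<and> f \<noteq> 0 \<and> poly f a = 0" for f
  have "\<exists>f. P f" using assms(2) by (auto simp: algebraic_over_def P_def)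
  then obtain g where g: "P g" "\<And>f. P f \<Longrightarrow> degree g \<le> degree f"
    using ex_has_least_nat[of P _ degree] by blast
  have deg: "degree g > 0"
  proof (rule ccontr)
    assume "\<not> degree g > 0"
    then obtain c where "g = [:c:]" by (metis degree_eq_zeroE neq0_conv)
    then show False using g(1) by (auto simp: P_def)
  qed
  have "poly (pderiv g) a \<noteq> 0"
  proof
    assume "poly (pderiv g) a = 0"
    moreover have "pderiv g \<noteq> 0" using deg by (simp add: pderiv_eq_0_iff)
    ultimately have "P (pderiv g)"
      using g(1) polys_over_closed(7)[OF K] by (simp add: P_def)
    then show False using g(2)[of "pderiv g"] deg by (simp add: degree_pderiv)
  qed
  moreover have "coeff g 0 \<noteq> 0" if "a \<noteq> 0"
  proof
    assume *: "coeff g 0 = 0"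
    obtain c h where gh: "g = pCons c h" by (cases g)
    with * g(1) that have "P h" "h \<noteq> 0" by (auto simp: P_def polys_over_pCons)
    with g(2)[of h] show False by (simp add: gh)
  qed
  ultimately show ?thesis using g by (intro bexI[of _ g]) (auto simp: P_def)
qed

text \<open>
  The minimal polynomial \<open>g\<close> dictates \<open>a'\<close>. Every other \<open>f\<close> that vanishes at \<open>a\<close> is then handled by
  descent on its degree: subtracting a multiple of \<open>g\<close> removes the leading term of
  \<open>lead_coeff g * f\<close>, and as \<open>g\<close> evaluates to \<open>0\<close> the remainder has the same evaluation as
  \<open>lead_coeff g * f\<close>.
\<close>

lemma extend_derivation_algebraic:
  assumes D: "derivation K D" and "algebraic_over K a"
  shows "\<exists>K' D'. derivation_extends K D K' D' \<and> a \<in> K'"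
proof -
  have K: "rat_subring K" using D by (simp add: derivation_def)
  note pc = polys_over_closed[OF K]
  obtain g where g: "g \<in> polys_over K" "g \<noteq> 0" "poly g a = 0" "poly (pderiv g) a \<noteq> 0"
    and min: "\<forall>f\<in>polys_over K. f \<noteq> 0 \<longrightarrow> poly f a = 0 \<longrightarrow> degree g \<le> degree f"
    using minimal_polynomial[OF K assms(2)] by blast
  define a' where "a' = - poly (map_poly D g) a / poly (pderiv g) a"
  let ?E = "derivation_eval D a a'"
  have Eg: "?E g = 0" using g(4) by (simp add: derivation_eval_def a'_def)
  have lg: "lead_coeff g \<in> K" using g(1) by (simp add: polys_over_def)
  have "?E f = 0" if "f \<in> polys_over K" "poly f a = 0" for f
    using that
  proof (induction "degree f" arbitrary: f rule: less_induct)
    case less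
    show ?case
    proof (cases "f = 0")
      case True
      then show ?thesis by (simp add: derivation_eval_def)
    next
      case False
      have le: "degree g \<le> degree f" using min less.prems False by blast
      have lf: "lead_coeff f \<in> K" using less.prems by (simp add: polys_over_def)
      define u v where "u = [:lead_coeff g:]" and "v = monom (lead_coeff f) (degree f - degree g)"
      have uv: "u \<in> polys_over K" "v \<in> polys_over K"
        unfolding u_def v_def using lf lg pc by auto
      define r where "r = u * f - v * g"
      have r: "r \<in> polys_over K" "poly r a = 0"
        unfolding r_def using less.prems g uv by (auto intro!: pc)
      have Er: "?E r = lead_coeff g * ?E f"
        unfolding r_def using less.prems g(1,3) uv Eg
        by (simp add: derivation_eval_diff[OF D] derivation_eval_mult[OF D] pc)
          (simp add: u_def)
      have "?E r = 0"
      proof (cases "degree f = 0")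
        case True
        then obtain c where "f = [:c:]" by (metis degree_eq_zeroE)
        with less.prems False show ?thesis by auto
      next
        case f0: False
        have "degree r < degree f"
        proof -
          have "degree (u * f) \<le> degree f" by (simp add: u_def)
          moreover have "degree (v * g) \<le> degree f"
            using degree_mult_le[of v g] degree_monom_le[of "lead_coeff f" "degree f - degree g"] le
            unfolding v_def by linarith
          ultimately have "degree r \<le> degree f" unfolding r_def by (rule degree_diff_le)
          moreover have "coeff r (degree f) = 0"
            using le by (simp add: r_def u_def v_def coeff_monom_mult)
          ultimately show ?thesis
            using f0 by (metis degree_0 le_neq_implies_less leading_coeff_0_iff neq0_conv)
        qed
        from less.hyps[OF this r] show ?thesis .
      qed
      with Er g(2) show ?thesis by simp
    qed
  qed
  from adjoin_derivation[OF D this] show ?thesis by blast 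
qed

lemma extend_derivation_transcendental:
  assumes D: "derivation K D" and "\<not> algebraic_over K a"
  shows "\<exists>K' D'. derivation_extends K D K' D' \<and> a \<in> K' \<and> D' a = 1"
proof -
  have "derivation_eval D a 1 f = 0" if "f \<in> polys_over K" "poly f a = 0" for f
  proof -
    have "f = 0" using that assms(2) by (auto simp: algebraic_over_def)
    then show ?thesis by (simp add: derivation_eval_def)
  qed
  from adjoin_derivation[OF D this] show ?thesis by blast 
qed

lemma extend_derivation:
  assumes "finite A" "derivation K D"
  shows "\<exists>K' D'. derivation_extends K D K' D' \<and> A \<subseteq> K'"
  using assms
proof (induction A rule: finite_induct)
  case empty
  then have "derivation_extends K D K D" by (simp add: derivation_extends_def)
  then show ?case by blast
next
  case (insert a A)
  then obtain K1 D1 where 1: "derivation_extends K D K1 D1" "A \<subseteq> K1" by blast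
  then have D1: "derivation K1 D1" by (simp add: derivation_extends_def)
  obtain K2 D2 where 2: "derivation_extends K1 D1 K2 D2" "a \<in> K2"
    using extend_derivation_algebraic[OF D1] extend_derivation_transcendental[OF D1] by blast
  have "derivation_extends K D K2 D2" "insert a A \<subseteq> K2"
    using 1 2 by (auto simp: derivation_extends_def)
  then show ?case by blast
qed

text \<open>
  Apply \<open>D\<close> to the minimal equation of \<open>a\<close>: all terms but the derivative of the polynomial at \<open>a\<close>,
  times \<open>D a\<close>, vanish, and that derivative is not \<open>0\<close>.
\<close>

lemma derivation_vanishes_on_algebraic:
  assumes D: "derivation L D" and K: "rat_subring K" "K \<subseteq> L" "\<And>x. x \<in> K \<Longrightarrow> D x = 0"
    and a: "a \<in> L" "algebraic_over K a"
  shows "D a = 0"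
proof -
  obtain g where g: "g \<in> polys_over K" "poly g a = 0" "poly (pderiv g) a \<noteq> 0"
    using minimal_polynomial[OF K(1) a(2)] by blast
  have "map_poly D g = 0"
    by (rule poly_eqI)
      (use g(1) K(3) in \<open>simp add: coeff_map_poly derivation_simps[OF D] polys_over_def\<close>)
  moreover have "g \<in> polys_over L" using g(1) K(2) by (auto simp: polys_over_def)
  ultimately have "poly (pderiv g) a * D a = 0"
    using derivation_poly[OF D _ a(1), of g] g(2)
    by (simp add: derivation_eval_def derivation_simps[OF D])
  then show ?thesis using g(3) by simp
qed

definition partial_deriv :: "'x \<Rightarrow> (('x \<Rightarrow> complex) \<Rightarrow> complex) \<Rightarrow> ('x \<Rightarrow> complex) \<Rightarrow> complex" where
  "partial_deriv i f x = deriv (\<lambda>t. f (x(i := t))) (x i)"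

lemma ratpoly_differentiable:
  "f \<in> ratpoly S \<Longrightarrow> (\<lambda>t. f (x(i := t))) field_differentiable at z"
proof (induction rule: ratpoly.induct)
  case (var j)
  then show ?case by (cases "i = j") auto
qed (auto intro: derivative_intros)

lemma partial_deriv_const: "partial_deriv i (\<lambda>x. c) = (\<lambda>x. 0)"
  by (simp add: partial_deriv_def fun_eq_iff)

lemma partial_deriv_var: "partial_deriv i (\<lambda>x. x j) = (\<lambda>x. if i = j then 1 else 0)"
  by (auto simp: partial_deriv_def fun_eq_iff)

lemma partial_deriv_add:
  "f \<in> ratpoly S \<Longrightarrow> g \<in> ratpoly S \<Longrightarrow> partial_deriv i (\<lambda>x. f x + g x) = (\<lambda>x. partial_deriv i f x + partial_deriv i g x)"
  unfolding partial_deriv_def fun_eq_iff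
  by (intro allI deriv_add ratpoly_differentiable)

lemma partial_deriv_mult:
  assumes "f \<in> ratpoly S" "g \<in> ratpoly S"
  shows "partial_deriv i (\<lambda>x. f x * g x) = (\<lambda>x. f x * partial_deriv i g x + partial_deriv i f x * g x)"
  unfolding partial_deriv_def fun_eq_iff
  using deriv_mult[OF ratpoly_differentiable[OF assms(1)] ratpoly_differentiable[OF assms(2)]]
  by simp

lemma partial_deriv_ratpoly: "f \<in> ratpoly S \<Longrightarrow> partial_deriv i f \<in> ratpoly S"
proof (induction rule: ratpoly.induct)
  case (const c)
  then show ?case by (simp add: partial_deriv_const ratpoly_zero)
next
  case (var j)
  then show ?case by (cases "i = j") (simp_all add: partial_deriv_var ratpoly_zero ratpoly_one)
next
  case (add f g)
  then show ?case by (simp add: partial_deriv_add ratpoly.add)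
next
  case (mult f g)
  then show ?case by (simp add: partial_deriv_mult ratpoly.add ratpoly.mult)
qed

text \<open>
  The ring generated over the rationals by the entries \<open>x i\<close> with \<open>i \<in> S\<close>.
\<close>

definition vals :: "'x set \<Rightarrow> ('x \<Rightarrow> complex) \<Rightarrow> complex set" where
  "vals S x = (\<lambda>f. f x) ` ratpoly S"

lemma rat_subring_vals: "rat_subring (vals S x)"
  unfolding rat_subring_def vals_def
proof (intro conjI ballI allI)
  show "of_rat c \<in> (\<lambda>f. f x) ` ratpoly S" for c
    by (rule image_eqI[OF _ ratpoly.const]) simp
  fix a b assume "a \<in> (\<lambda>f. f x) ` ratpoly S" "b \<in> (\<lambda>f. f x) ` ratpoly S"
  then obtain f g where fg: "f \<in> ratpoly S" "a = f x" "g \<in> ratpoly S" "b = g x" by blast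
  show "a + b \<in> (\<lambda>f. f x) ` ratpoly S"
    by (rule image_eqI[OF _ ratpoly.add[OF fg(1,3)]]) (simp add: fg)
  show "a * b \<in> (\<lambda>f. f x) ` ratpoly S"
    by (rule image_eqI[OF _ ratpoly.mult[OF fg(1,3)]]) (simp add: fg)
qed

lemma vals_var: "i \<in> S \<Longrightarrow> x i \<in> vals S x"
  unfolding vals_def by (rule image_eqI[OF _ ratpoly.var]) auto

lemma ratpoly_in_subring:
  "f \<in> ratpoly S \<Longrightarrow> rat_subring K \<Longrightarrow> (\<And>i. i \<in> S \<Longrightarrow> x i \<in> K) \<Longrightarrow> f x \<in> K"
  by (induction rule: ratpoly.induct) (auto simp: rat_subring_closed)

lemma vals_subset:
  "rat_subring K \<Longrightarrow> (\<And>i. i \<in> S \<Longrightarrow> x i \<in> K) \<Longrightarrow> vals S x \<subseteq> K"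
  unfolding vals_def using ratpoly_in_subring by blast

lemma derivation_chain_rule:
  assumes D: "derivation K D" and "finite S" and x: "\<And>i. i \<in> S \<Longrightarrow> x i \<in> K"
    and "f \<in> ratpoly S"
  shows "D (f x) = (\<Sum>i\<in>S. partial_deriv i f x * D (x i))"
  using assms(4)
proof (induction rule: ratpoly.induct)
  case (const c)
  show ?case by (simp add: partial_deriv_const derivation_simps[OF D])
next
  case (var j)
  have "(\<Sum>i\<in>S. (if i = j then 1 else 0) * D (x i)) = (\<Sum>i\<in>S. if i = j then D (x i) else 0)"
    by (rule sum.cong) auto
  with var assms(2) show ?case by (simp add: partial_deriv_var)
next
  case (add f g)
  have K: "rat_subring K" using D by (simp add: derivation_def)
  have "f x \<in> K" "g x \<in> K" using add ratpoly_in_subring[where x=x, OF _ K x] by blast+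
  with add show ?case
    by (simp add: derivation_simps[OF D] partial_deriv_add[OF add(1,2)] distrib_right sum.distrib)
next
  case (mult f g)
  have K: "rat_subring K" using D by (simp add: derivation_def)
  have "f x \<in> K" "g x \<in> K" using mult ratpoly_in_subring[where x=x, OF _ K x] by blast+
  with mult show ?case
    by (simp add: derivation_simps[OF D] partial_deriv_mult[OF mult(1,2)] distrib_right sum.distrib
        sum_distrib_left sum_distrib_right algebra_simps)
qed

lemma poly_over_vals_lift:
  assumes "P \<in> polys_over (vals S x)"
  shows "\<exists>b. \<forall>i. b i \<in> ratpoly S \<and> b i x = coeff P i"
proof -
  have "\<forall>i. \<exists>f. f \<in> ratpoly S \<and> f x = coeff P i"
  proof
    fix i
    have "coeff P i \<in> vals S x" using assms by (simp add: polys_over_def)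
    then show "\<exists>f. f \<in> ratpoly S \<and> f x = coeff P i" by (auto simp: vals_def)
  qed
  then show ?thesis by (rule choice)
qed

text \<open>
  A one-variable polynomial over the ring generated by the entries of \<open>x\<close> is tied to the point \<open>x\<close>.
  Lifting its coefficients to polynomial functions makes it a polynomial relation that can be
  transported to other points.
\<close>

lemma lift_relation:
  assumes "P \<in> polys_over (vals S x)" "f \<in> ratpoly T" "S \<subseteq> T"
  shows "\<exists>h\<in>ratpoly T. \<forall>y. (\<forall>i\<in>S. y i = x i) \<longrightarrow> h y = poly P (f y)"
proof -
  obtain b where b: "\<And>i. b i \<in> ratpoly S" "\<And>i. b i x = coeff P i"
    using poly_over_vals_lift[OF assms(1)] by blast
  define h where "h y = (\<Sum>i\<le>degree P. b i y * f y ^ i)" for y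
  have "h \<in> ratpoly T"
    unfolding h_def
    by (intro ratpoly_sum ratpoly.mult ratpoly_power assms ratpoly_mono[OF b(1) assms(3)])
  moreover have "h y = poly P (f y)" if "\<And>i. i \<in> S \<Longrightarrow> y i = x i" for y
    unfolding h_def poly_altdef
    by (rule sum.cong) (use ratpoly_cong_on[OF b(1) that] b(2) in auto)
  ultimately show ?thesis by blast
qed

text \<open>
  An algebraic equation for one coordinate over the others would be an identity in all coordinates;
  moving only that coordinate shows that the equation has every number as a root.
\<close>

lemma generic_coord_transcendental:
  assumes "generic V p" "j \<in> V \<times> UNIV" "S \<subseteq> V \<times> UNIV - {j}"
  shows "\<not> algebraic_over (vals S (coords p)) (coords p j)"
proof
  assume "algebraic_over (vals S (coords p)) (coords p j)"
  then obtain P where P: "P \<in> polys_over (vals S (coords p))" "P \<noteq> 0" "poly P (coords p j) = 0"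
    by (auto simp: algebraic_over_def)
  have ST: "S \<subseteq> V \<times> UNIV" using assms(3) by blast
  obtain h where h: "h \<in> ratpoly (V \<times> UNIV)"
    "\<forall>y. (\<forall>i\<in>S. y i = coords p i) \<longrightarrow> h y = poly P (y j)"
    using lift_relation[OF P(1) ratpoly.var[OF assms(2)] ST] by (rule bexE)
  have z: "h y = 0" for y
    using generic_ratpoly_identity[OF assms(1) h(1)] h(2) P(3) by simp
  have "poly P t = 0" for t
    using h(2)[rule_format, of "(coords p)(j := t)"] z assms(3) by fastforce
  then show False using P(2) poly_all_0_iff_0 by blast
qed

text \<open>
  At a generic point the partial derivative along a coordinate is a derivation of the ring of
  values, because that coordinate is transcendental over the others.
\<close>

lemma coordinate_derivation:
  assumes "generic V p" "j \<in> V \<times> UNIV"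
  obtains K D where "derivation K D" "vals (V \<times> UNIV) (coords p) \<subseteq> K"
    "\<forall>i\<in>V \<times> UNIV. D (coords p i) = (if i = j then 1 else 0)"
    "\<forall>x\<in>vals (V \<times> UNIV - {j}) (coords p). D x = 0"
proof -
  let ?S = "V \<times> UNIV - {j}"
  have "derivation (vals ?S (coords p)) (\<lambda>x. 0)"
    by (simp add: derivation_def rat_subring_vals)
  from extend_derivation_transcendental[OF this generic_coord_transcendental[OF assms subset_refl]]
  obtain K D where "derivation_extends (vals ?S (coords p)) (\<lambda>x. 0) K D"
    and Dj: "coords p j \<in> K" "D (coords p j) = 1" by blast
  then have D: "derivation K D" "vals ?S (coords p) \<subseteq> K" "\<forall>x\<in>vals ?S (coords p). D x = 0"
    by (auto simp: derivation_extends_def)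
  have "coords p i \<in> K" if "i \<in> V \<times> UNIV" for i
    using that D(2) Dj(1) vals_var[of i ?S "coords p"] by (cases "i = j") auto
  then have "vals (V \<times> UNIV) (coords p) \<subseteq> K"
    using D(1) by (intro vals_subset) (auto simp: derivation_def)
  moreover have "D (coords p i) = (if i = j then 1 else 0)" if "i \<in> V \<times> UNIV" for i
    using that D(3) Dj(2) vals_var[of i ?S "coords p"] by (cases "i = j") auto
  ultimately show ?thesis using that D by blast
qed


section \<open>Affine interpolation at generic points\<close>

text \<open>
  Functions of a vertex that are affine in the coordinates \<open>I\<close> of its position. The ring \<open>R\<close> of
  coefficients is recorded because the induction below needs to know which coordinates of the
  configuration enter the coefficients.
\<close>

inductive_set affine_span ::
    "complex set \<Rightarrow> 'd set \<Rightarrow> ('a \<Rightarrow> complex ^ 'd::finite) \<Rightarrow> ('a \<Rightarrow> complex) set" for R I p where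
  const: "c \<in> R \<Longrightarrow> (\<lambda>y. c) \<in> affine_span R I p"
| coord: "i \<in> I \<Longrightarrow> (\<lambda>y. p y $ i) \<in> affine_span R I p"
| add: "g \<in> affine_span R I p \<Longrightarrow> h \<in> affine_span R I p \<Longrightarrow> (\<lambda>y. g y + h y) \<in> affine_span R I p"
| scale: "c \<in> R \<Longrightarrow> g \<in> affine_span R I p \<Longrightarrow> (\<lambda>y. c * g y) \<in> affine_span R I p"

lemma affine_span_mono:
  "g \<in> affine_span R I p \<Longrightarrow> R \<subseteq> R' \<Longrightarrow> I \<subseteq> I' \<Longrightarrow> g \<in> affine_span R' I' p"
  by (induction rule: affine_span.induct) (auto intro: affine_span.intros)

lemma affine_span_sum:
  "rat_subring R \<Longrightarrow> (\<And>k. k \<in> K \<Longrightarrow> g k \<in> affine_span R I p) \<Longrightarrow>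
    (\<lambda>y. \<Sum>k\<in>K. g k y) \<in> affine_span R I p"
  by (induction K rule: infinite_finite_induct)
    (auto intro: affine_span.intros rat_subring_closed)

lemma affine_span_diff:
  assumes "rat_subring R" "g \<in> affine_span R I p" "h \<in> affine_span R I p"
  shows "(\<lambda>y. g y - h y) \<in> affine_span R I p"
  using affine_span.add[OF assms(2) affine_span.scale[OF _ assms(3), of "-1"]]
    rat_subring_closed(1)[OF assms(1), of "-1"] by simp

lemma affine_span_in_subring:
  "g \<in> affine_span R I p \<Longrightarrow> rat_subring L \<Longrightarrow> R \<subseteq> L \<Longrightarrow> (\<And>i. i \<in> I \<Longrightarrow> p y $ i \<in> L) \<Longrightarrow> g y \<in> L"
  by (induction rule: affine_span.induct) (auto simp: rat_subring_closed)

lemma vals_mono: "S \<subseteq> T \<Longrightarrow> vals S x \<subseteq> vals T x"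
  unfolding vals_def using ratpoly_mono by blast

text \<open>
  Interpolation matrices of generic points are invertible; the induction eliminates one vertex and
  one coordinate at a time, and cross-multiplies instead of dividing. The new vertex \<open>k'\<close> and the new
  coordinate \<open>j\<close> give a function \<open>r\<close> that vanishes on the old vertices. It does not vanish at \<open>k'\<close>,
  since \<open>r k' = 0\<close> would be a linear equation for the \<open>j\<close>-th coordinate of \<open>k'\<close> over the remaining
  coordinates.
\<close>

lemma generic_interpolation_over_subring:
  fixes p :: "'a \<Rightarrow> complex ^ 'd::finite"
  assumes "finite K" "K \<noteq> {}" "generic V p" "K \<subseteq> V" "card K = Suc (card I)"
  shows "\<exists>c\<in>vals (K \<times> I) (coords p). c \<noteq> 0 \<and>
    (\<forall>k\<in>K. \<exists>g\<in>affine_span (vals (K \<times> I) (coords p)) I p. \<forall>y\<in>K. g y = (if y = k then c else 0))"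
  using assms
proof (induction K arbitrary: I rule: finite_ne_induct)
  case (singleton k)
  let ?R = "vals ({k} \<times> I) (coords p)"
  have "1 \<in> ?R" by (rule rat_subring_closed(3)[OF rat_subring_vals])
  then show ?case
    by (intro bexI[of _ 1] conjI ballI bexI[OF _ affine_span.const[of 1]]) auto
next
  case (insert k' K)
  let ?x = "coords p"
  have "card I = card K" using insert by simp
  then have "card I > 0" using insert by (simp add: card_gt_0_iff)
  then obtain j where j: "j \<in> I" by fastforce
  define J where "J = I - {j}"
  have IJ: "I = insert j J" "j \<notin> J" "J \<subseteq> I" using j by (auto simp: J_def)
  have "card K = Suc (card J)" using \<open>card I = card K\<close> IJ by simp
  then obtain c G where c: "c \<in> vals (K \<times> J) ?x" "c \<noteq> 0"
    and G: "\<And>k. k \<in> K \<Longrightarrow> G k \<in> affine_span (vals (K \<times> J) ?x) J p"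
      "\<And>k y. k \<in> K \<Longrightarrow> y \<in> K \<Longrightarrow> G k y = (if y = k then c else 0)"
    using insert.IH[of J] insert.prems by (metis insert_subset)
  define R where "R = vals (insert k' K \<times> I) ?x"
  define S where "S = insert k' K \<times> I - {(k', j)}"
  have R: "rat_subring R" by (simp add: R_def rat_subring_vals)
  have subS: "vals (K \<times> J) ?x \<subseteq> vals S ?x"
    by (rule vals_mono) (use IJ insert.hyps in \<open>auto simp: S_def\<close>)
  have subR: "vals S ?x \<subseteq> R" unfolding R_def by (rule vals_mono) (auto simp: S_def)
  have coordS: "p y $ i \<in> vals S ?x" if "y \<in> insert k' K" "i \<in> I" "(y, i) \<noteq> (k', j)" for y i
    using vals_var[of "(y, i)" S ?x] that by (simp add: S_def)
  have coordR: "p y $ i \<in> R" if "y \<in> insert k' K" "i \<in> I" for y i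
    using vals_var[of "(y, i)" "insert k' K \<times> I" ?x] that by (simp add: R_def)
  have GR: "G k \<in> affine_span R I p" if "k \<in> K" for k
    by (rule affine_span_mono[OF G(1)[OF that]]) (use subS subR IJ in auto)
  have cR: "c \<in> R" using c subS subR by blast
  \<comment> \<open>\<open>c\<close> times the coordinate \<open>j\<close> minus its interpolation on \<open>K\<close> by the coordinates \<open>J\<close>\<close>
  define r where "r y = c * p y $ j - (\<Sum>k\<in>K. p k $ j * G k y)" for y
  have r: "r \<in> affine_span R I p"
    unfolding r_def using j coordR cR
    by (intro affine_span_diff[OF R] affine_span_sum[OF R] affine_span.scale affine_span.coord GR)
      auto
  have r0: "r y = 0" if "y \<in> K" for y
  proof -
    have "(\<Sum>k\<in>K. p k $ j * G k y) = (\<Sum>k\<in>K. if k = y then p y $ j * c else 0)"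
      by (rule sum.cong) (use that G(2) in auto)
    then show ?thesis using that insert.hyps by (simp add: r_def)
  qed
  have "r k' \<noteq> 0"
  proof
    assume rk: "r k' = 0"
    define b where "b = (\<Sum>k\<in>K. p k $ j * G k k')"
    have "G k k' \<in> vals S ?x" if "k \<in> K" for k
      by (rule affine_span_in_subring[OF G(1)[OF that] rat_subring_vals subS])
        (use IJ in \<open>auto intro!: coordS\<close>)
    then have "b \<in> vals S ?x"
      unfolding b_def using insert.hyps j
      by (intro rat_subring_sum[OF rat_subring_vals] rat_subring_closed(5)[OF rat_subring_vals] coordS)
        auto
    then have "[:- b, c:] \<in> polys_over (vals S ?x)"
      using c subS
      by (auto simp: polys_over_pCons polys_over_closed rat_subring_vals rat_subring_closed)
    moreover have "poly [:- b, c:] (?x (k', j)) = 0" using rk by (simp add: r_def b_def algebra_simps)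
    ultimately have "algebraic_over (vals S ?x) (?x (k', j))"
      using c(2) unfolding algebraic_over_def by (metis pCons_eq_0_iff)
    moreover have "\<not> algebraic_over (vals S ?x) (?x (k', j))"
      by (rule generic_coord_transcendental[OF insert.prems(1)])
        (use insert.prems in \<open>auto simp: S_def\<close>)
    ultimately show False by blast
  qed
  have val: "g y \<in> R" if "g \<in> affine_span R I p" "y \<in> insert k' K" for g y
    by (rule affine_span_in_subring[OF that(1) R subset_refl]) (use coordR that(2) in auto)
  show ?case
    unfolding R_def[symmetric]
  proof (intro bexI[of _ "c * r k'"] conjI ballI)
    show "c * r k' \<in> R" using cR val[OF r] by (simp add: rat_subring_closed[OF R])
    show "c * r k' \<noteq> 0" using c \<open>r k' \<noteq> 0\<close> by simp
    fix k assume k: "k \<in> insert k' K"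
    show "\<exists>g\<in>affine_span R I p. \<forall>y\<in>insert k' K. g y = (if y = k then c * r k' else 0)"
    proof (cases "k = k'")
      case True
      show ?thesis
        by (rule bexI[OF _ affine_span.scale[OF cR r]]) (use True r0 insert.hyps in auto)
    next
      case False
      then have "k \<in> K" using k by simp
      show ?thesis
        by (rule bexI[OF _ affine_span_diff[OF R
              affine_span.scale[OF val[OF r] GR[OF \<open>k \<in> K\<close>], of k']
              affine_span.scale[OF val[OF GR[OF \<open>k \<in> K\<close>]] r, of k']]])
          (use False r0 G(2)[OF \<open>k \<in> K\<close>] insert.hyps in auto)
    qed
  qed
qed

lemma generic_affine_interpolation:
  fixes p :: "'a \<Rightarrow> complex ^ 'd::finite"
  assumes "generic V p" "finite K" "K \<subseteq> V" "card K \<le> CARD('d) + 1" "k \<in> K"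
  shows "\<exists>g\<in>affine_span UNIV UNIV p. \<forall>y\<in>K. g y = (if y = k then 1 else 0)"
proof -
  have "card K - 1 \<le> CARD('d)" using assms by simp
  then obtain I :: "'d set" where I: "card I = card K - 1"
    using obtain_subset_with_card_n by metis
  have "card K > 0" using assms by (auto simp: card_gt_0_iff)
  then have "card K = Suc (card I)" using I by simp
  then obtain c g where c: "c \<noteq> 0"
    and g: "g \<in> affine_span (vals (K \<times> I) (coords p)) I p" "\<forall>y\<in>K. g y = (if y = k then c else 0)"
    using generic_interpolation_over_subring[OF assms(2) _ assms(1,3)] assms(5) by blast
  have "(\<lambda>y. 1 / c * g y) \<in> affine_span UNIV UNIV p"
    by (intro affine_span.scale affine_span_mono[OF g(1)]) auto
  from bexI[OF _ this] g(2) c show ?thesis by simp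
qed

section \<open>Transfer of linear systems between conjugate rings\<close>

text \<open>
  \<open>T\<close> is the graph of an isomorphism between two subrings of the complex numbers. As a set of pairs it
  treats both sides alike, and no inverse or well-definedness has to be discussed.
\<close>

locale conjugate_pairs =
  fixes T :: "(complex \<times> complex) set"
  assumes rat: "(of_rat c, of_rat c) \<in> T"
    and add: "(x, x') \<in> T \<Longrightarrow> (y, y') \<in> T \<Longrightarrow> (x + y, x' + y') \<in> T"
    and mult: "(x, x') \<in> T \<Longrightarrow> (y, y') \<in> T \<Longrightarrow> (x * y, x' * y') \<in> T"
    and zero_iff: "(x, x') \<in> T \<Longrightarrow> x = 0 \<longleftrightarrow> x' = 0"
begin

lemma zero: "(0, 0) \<in> T" and one: "(1, 1) \<in> T"
  using rat[of 0] rat[of 1] by simp_all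

lemma uminus: "(x, x') \<in> T \<Longrightarrow> (- x, - x') \<in> T"
  using mult[OF rat[of "-1"], of x x'] by simp

lemma diff: "(x, x') \<in> T \<Longrightarrow> (y, y') \<in> T \<Longrightarrow> (x - y, x' - y') \<in> T"
  using add[OF _ uminus] by fastforce

lemma sum: "(\<And>i. i \<in> I \<Longrightarrow> (f i, f' i) \<in> T) \<Longrightarrow> (sum f I, sum f' I) \<in> T"
  by (induction I rule: infinite_finite_induct) (auto intro: zero add)

text \<open>
  A linear system that is solvable over the complex numbers remains solvable after its coefficients
  are replaced by their conjugates. The unknowns are transported one at a time: if \<open>s v\<close> satisfies a
  linear equation over the ring and the unknowns already treated, then \<open>t v\<close> is defined by the
  conjugate equation; if not, \<open>v\<close> occurs in no relation and \<open>t v\<close> is arbitrary.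
\<close>

lemma transfer_linear_solution:
  assumes "finite V"
  shows "\<exists>t. \<forall>c0 c0' c c'. (c0, c0') \<in> T \<longrightarrow> (\<forall>v\<in>V. (c v, c' v) \<in> T) \<longrightarrow>
    c0 + (\<Sum>v\<in>V. c v * s v) = 0 \<longrightarrow> c0' + (\<Sum>v\<in>V. c' v * t v) = 0"
  using assms
proof (induction V rule: finite_induct)
  case empty
  show ?case using zero_iff by auto
next
  case (insert v V)
  obtain t where t: "\<forall>c0 c0' c c'. (c0, c0') \<in> T \<longrightarrow> (\<forall>v\<in>V. (c v, c' v) \<in> T) \<longrightarrow>
    c0 + (\<Sum>v\<in>V. c v * s v) = 0 \<longrightarrow> c0' + (\<Sum>v\<in>V. c' v * t v) = 0"
    using insert.IH by (rule exE)
  have cong: "(\<Sum>w\<in>V. c' w * (t(v := z)) w) = (\<Sum>w\<in>V. c' w * t w)" for c' z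
    by (rule sum.cong) (use insert.hyps in auto)
  show ?case
  proof (cases "\<exists>b b' c0 c0' c c'. (b, b') \<in> T \<and> b \<noteq> 0 \<and> (c0, c0') \<in> T \<and>
      (\<forall>w\<in>V. (c w, c' w) \<in> T) \<and> b * s v + (c0 + (\<Sum>w\<in>V. c w * s w)) = 0")
    case True
    then obtain b b' c0 c0' c c' where b: "(b, b') \<in> T" "b \<noteq> 0" and c: "(c0, c0') \<in> T"
      "\<And>w. w \<in> V \<Longrightarrow> (c w, c' w) \<in> T" and rel: "b * s v + (c0 + (\<Sum>w\<in>V. c w * s w)) = 0"
      by blast
    have b': "b' \<noteq> 0" using b zero_iff by blast
    define z where "z = - (c0' + (\<Sum>w\<in>V. c' w * t w)) / b'"
    have z: "b' * z = - (c0' + (\<Sum>w\<in>V. c' w * t w))" using b' by (simp add: z_def)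
    show ?thesis
    proof (intro exI[of _ "t(v := z)"] allI impI)
      fix d0 d0' d d'
      assume d: "(d0, d0') \<in> T" "\<forall>w\<in>insert v V. (d w, d' w) \<in> T"
        and d_rel: "d0 + (\<Sum>w\<in>insert v V. d w * s w) = 0"
      have expand: "(b * d0 - d v * c0) + (\<Sum>w\<in>V. (b * d w - d v * c w) * s w)
        = b * (d0 + (\<Sum>w\<in>V. d w * s w)) - d v * (c0 + (\<Sum>w\<in>V. c w * s w))" for b d0 d c0 c and s :: "_ \<Rightarrow> complex"
        by (simp add: sum_subtractf sum_distrib_left algebra_simps)
      \<comment> \<open>The combination of the two relations in which \<open>s v\<close> cancels only involves the old unknowns.\<close>
      have "(b' * d0' - d' v * c0') + (\<Sum>w\<in>V. (b' * d' w - d' v * c' w) * t w) = 0"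
      proof (rule t[rule_format, of "b * d0 - d v * c0" _ "\<lambda>w. b * d w - d v * c w"])
        show "(b * d0 - d v * c0, b' * d0' - d' v * c0') \<in> T"
          using b c d by (intro diff mult) auto
        show "(b * d w - d v * c w, b' * d' w - d' v * c' w) \<in> T" if "w \<in> V" for w
          using b c d that by (intro diff mult) auto
        have "d0 + (\<Sum>w\<in>V. d w * s w) = - d v * s v"
          using d_rel insert.hyps by (simp add: eq_neg_iff_add_eq_0 algebra_simps)
        moreover have "c0 + (\<Sum>w\<in>V. c w * s w) = - b * s v"
          using rel by (simp add: eq_neg_iff_add_eq_0 algebra_simps)
        ultimately show "b * d0 - d v * c0 + (\<Sum>w\<in>V. (b * d w - d v * c w) * s w) = 0"
          unfolding expand by simp
      qed
      then have "b' * (d0' + (\<Sum>w\<in>V. d' w * t w)) = d' v * (c0' + (\<Sum>w\<in>V. c' w * t w))"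
        unfolding expand by simp
      also have "c0' + (\<Sum>w\<in>V. c' w * t w) = - (b' * z)" using z by simp
      finally have "b' * (d0' + (\<Sum>w\<in>V. d' w * t w) + d' v * z) = 0"
        by (simp add: algebra_simps eq_neg_iff_add_eq_0)
      with b' have "d0' + (\<Sum>w\<in>V. d' w * t w) + d' v * z = 0" by simp
      then show "d0' + (\<Sum>w\<in>insert v V. d' w * (t(v := z)) w) = 0"
        using insert.hyps by (simp add: cong algebra_simps del: fun_upd_apply) (simp add: mult.commute)
    qed
  next
    case False
    show ?thesis
    proof (intro exI[of _ t] allI impI)
      fix d0 d0' d d'
      assume d: "(d0, d0') \<in> T" "\<forall>w\<in>insert v V. (d w, d' w) \<in> T"
        and d_rel: "d0 + (\<Sum>w\<in>insert v V. d w * s w) = 0"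
      have *: "d v * s v + (d0 + (\<Sum>w\<in>V. d w * s w)) = 0"
        using d_rel insert.hyps by (simp add: algebra_simps)
      have dv: "d v = 0"
      proof (rule ccontr)
        assume "d v \<noteq> 0"
        then have "\<exists>b b' c0 c0' c c'. (b, b') \<in> T \<and> b \<noteq> 0 \<and> (c0, c0') \<in> T \<and>
            (\<forall>w\<in>V. (c w, c' w) \<in> T) \<and> b * s v + (c0 + (\<Sum>w\<in>V. c w * s w)) = 0"
          using d * by (intro exI[of _ "d v"] exI[of _ "d' v"] exI[of _ d0] exI[of _ d0']
              exI[of _ d] exI[of _ d']) simp
        with False show False by (rule notE)
      qed
      then have "d' v = 0" using d(2) zero_iff by auto
      moreover have "d0' + (\<Sum>w\<in>V. d' w * t w) = 0"
        by (rule t[rule_format, of d0 _ d]) (use d d_rel dv insert.hyps in auto)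
      ultimately show "d0' + (\<Sum>w\<in>insert v V. d' w * t w) = 0"
        using insert.hyps by simp
    qed
  qed
qed

end

section \<open>Linked pairs\<close>

lemma edge_jacobian_eq_pd:
  "edge_jacobian p e j = partial_deriv j (\<lambda>x. edge_sqlen (config_of x) e) (coords p)"
proof -
  obtain w i where j: "j = (w, i)" by (cases j)
  have "p(w := (\<chi> j. if j = i then z else p w $ j)) = config_of ((coords p)((w, i) := z))" for z
    by (auto simp: config_of_def fun_eq_iff vec_eq_iff)
  then show ?thesis by (simp add: j edge_jacobian_def partial_deriv_def)
qed

lemma derivation_edge_sqlen:
  fixes p :: "'a \<Rightarrow> complex ^ 'd::finite"
  assumes D: "derivation K D" and "finite V" "vals (V \<times> UNIV) (coords p) \<subseteq> K"
    and e: "e \<subseteq> V" "card e = 2"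
  shows "edge_sqlen p e \<in> K"
    "D (edge_sqlen p e) = (\<Sum>j\<in>V \<times> UNIV. edge_jacobian p e j * D (coords p j))"
proof -
  let ?f = "\<lambda>x. edge_sqlen (config_of x) e"
  have f: "?f \<in> ratpoly (V \<times> UNIV)" by (rule edge_sqlen_ratpoly[OF e])
  then have "?f (coords p) \<in> vals (V \<times> UNIV) (coords p)"
    unfolding vals_def by (rule imageI)
  then show "edge_sqlen p e \<in> K" using assms(3) by auto
  have "D (?f (coords p)) = (\<Sum>j\<in>V \<times> UNIV. partial_deriv j ?f (coords p) * D (coords p j))"
  proof (rule derivation_chain_rule[OF D _ _ f])
    show "finite (V \<times> (UNIV :: 'd set))" using assms(2) by simp
    show "coords p j \<in> K" if "j \<in> V \<times> UNIV" for j
      using vals_var[OF that, of "coords p"] assms(3) by blast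
  qed
  then show "D (edge_sqlen p e) = (\<Sum>j\<in>V \<times> UNIV. edge_jacobian p e j * D (coords p j))"
    by (simp add: edge_jacobian_eq_pd)
qed

text \<open>
  Adding the row of \<open>uv\<close> to a largest independent set of rows of \<open>G\<close> must destroy independence, as the
  rank does not increase. This happens at the generic configuration \<open>p0\<close> by which the matroid is
  defined; \<open>p\<close> serves only to show that \<open>p0\<close> is generic indeed.
\<close>

lemma rigidity_linked_row:
  fixes p :: "'a \<Rightarrow> complex ^ 'd::finite"
  assumes G: "is_graph G" and "generic (verts G) p" and "rigidity_linked TYPE('d) G u v"
    and uv: "{u, v} \<notin> edges G"
  obtains p0 :: "'a \<Rightarrow> complex ^ 'd" and F c where "generic (verts G) p0" "F \<subseteq> edges G"
    "\<forall>x\<in>verts G \<times> UNIV. edge_jacobian p0 {u, v} x = (\<Sum>e\<in>F. c e * edge_jacobian p0 e x)"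
proof -
  let ?D = "TYPE('d)"
  define p0 :: "'a \<Rightarrow> complex ^ 'd" where "p0 = (SOME p. generic (verts G) p)"
  have p0: "generic (verts G) p0" unfolding p0_def using assms(2) by (rule someI[of "generic (verts G)"])
  have "edges G \<subseteq> Pow (verts G)" using G by (auto simp: is_graph_def)
  then have finE: "finite (edges G)" using G by (meson finite_Pow_iff finite_subset is_graph_def)
  have indep: "rigidity_indep ?D G F \<longleftrightarrow> F \<subseteq> edges G \<and> rows_independent (verts G) p0 F" for F
    by (simp add: rigidity_indep_def p0_def)
  have indep': "rigidity_indep ?D (add_edge G u v) F \<longleftrightarrow>
      F \<subseteq> insert {u, v} (edges G) \<and> rows_independent (verts G) p0 F" for F
    by (simp add: rigidity_indep_def p0_def add_edge_def)
  let ?A = "card ` {F. rigidity_indep ?D G F}" and ?B = "card ` {F. rigidity_indep ?D (add_edge G u v) F}"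
  have fin: "finite ?A" "finite ?B"
    using finE unfolding indep indep' by (auto intro!: finite_imageI simp: Collect_conj_eq)
  have "{} \<in> {F. rigidity_indep ?D G F}" by (simp add: indep rows_independent_def)
  then have "?A \<noteq> {}" by blast
  then obtain F where F: "rigidity_indep ?D G F" "card F = Max ?A"
    using Max_in[OF fin(1)] by fastforce
  have FE: "F \<subseteq> edges G" and finF: "finite F" and uvF: "{u, v} \<notin> F"
    using F(1) finE uv by (auto simp: indep intro: finite_subset)
  have "\<not> rigidity_indep ?D (add_edge G u v) (insert {u, v} F)"
  proof
    assume "rigidity_indep ?D (add_edge G u v) (insert {u, v} F)"
    then have "card (insert {u, v} F) \<le> Max ?B" using fin(2) by (intro Max_ge) auto
    then show False
      using assms(3) F(2) finF uvF by (simp add: rigidity_linked_def rigidity_rank_def)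
  qed
  then have "\<not> rows_independent (verts G) p0 (insert {u, v} F)" using FE by (auto simp: indep')
  then obtain a where a: "\<And>x. x \<in> verts G \<times> UNIV \<Longrightarrow> (\<Sum>e\<in>insert {u, v} F. a e * edge_jacobian p0 e x) = 0"
    and nz: "\<exists>e\<in>insert {u, v} F. a e \<noteq> 0"
    unfolding rows_independent_def by blast
  have a': "a {u, v} * edge_jacobian p0 {u, v} x + (\<Sum>e\<in>F. a e * edge_jacobian p0 e x) = 0"
    if "x \<in> verts G \<times> UNIV" for x
    using a[OF that] finF uvF by simp
  have auv: "a {u, v} \<noteq> 0"
  proof
    assume 0: "a {u, v} = 0"
    with a' have "\<forall>x\<in>verts G \<times> UNIV. (\<Sum>e\<in>F. a e * edge_jacobian p0 e x) = 0" by simp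
    then have "\<forall>e\<in>F. a e = 0" using F(1) unfolding indep rows_independent_def by blast
    with 0 nz show False by auto
  qed
  have "edge_jacobian p0 {u, v} x = (\<Sum>e\<in>F. - a e / a {u, v} * edge_jacobian p0 e x)"
    if "x \<in> verts G \<times> UNIV" for x
  proof -
    have "(\<Sum>e\<in>F. - a e / a {u, v} * edge_jacobian p0 e x)
        = - (\<Sum>e\<in>F. a e * edge_jacobian p0 e x) / a {u, v}"
      by (simp add: sum_negf sum_divide_distrib)
    also have "\<dots> = edge_jacobian p0 {u, v} x"
    proof -
      have "(\<Sum>e\<in>F. a e * edge_jacobian p0 e x) = - (a {u, v} * edge_jacobian p0 {u, v} x)"
        using a'[OF that] by (rule minus_unique[symmetric])
      then show ?thesis using auv by simp
    qed
    finally show ?thesis by simp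
  qed
  then have "\<forall>x\<in>verts G \<times> UNIV. edge_jacobian p0 {u, v} x
      = (\<Sum>e\<in>F. (- a e / a {u, v}) * edge_jacobian p0 e x)" by (intro ballI)
  with p0 FE show ?thesis by (rule that[of p0 F "\<lambda>e. - a e / a {u, v}"])
qed


lemma algebraic_over_mono: "algebraic_over K a \<Longrightarrow> K \<subseteq> L \<Longrightarrow> algebraic_over L a"
  unfolding algebraic_over_def polys_over_def by blast

text \<open>
  The Jacobian criterion. If \<open>f (edge_sqlen p0)\<close> were transcendental over the edge lengths, some
  derivation would kill all edge lengths but not this number; by the chain rule it would then not
  kill the length of \<open>uv\<close>, although the differential of that length is a combination of the
  differentials of edge lengths. This yields an algebraic equation at \<open>p0\<close>, and genericity carries it
  over to \<open>p\<close>, its leading coefficient remaining nonzero.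
\<close>

lemma linked_algebraic:
  fixes p :: "'a \<Rightarrow> complex ^ 'd::finite"
  assumes G: "is_graph G" and p: "generic (verts G) p" and linked: "rigidity_linked TYPE('d) G u v"
    and uv: "{u, v} \<notin> edges G" "{u, v} \<subseteq> verts G" "u \<noteq> v"
    and f: "f \<in> ratpoly (insert {u, v} (edges G))"
  shows "algebraic_over (vals (edges G) (edge_sqlen p)) (f (edge_sqlen p))"
proof -
  let ?V = "verts G" and ?E = "edges G"
  let ?E' = "insert {u, v} ?E"
  have finV: "finite ?V" using G by (simp add: is_graph_def)
  have E': "e \<subseteq> ?V \<and> card e = 2" if "e \<in> ?E'" for e
    using that G uv by (auto simp: is_graph_def)
  then have finE': "finite ?E'"
    using finV by (meson PowI finite_Pow_iff finite_subset subsetI)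
  obtain p0 :: "'a \<Rightarrow> complex ^ 'd" and F c where p0: "generic ?V p0" and F: "F \<subseteq> ?E"
    and row: "\<forall>x\<in>?V \<times> UNIV. edge_jacobian p0 {u, v} x = (\<Sum>e\<in>F. c e * edge_jacobian p0 e x)"
    by (rule rigidity_linked_row[OF G p linked uv(1)])
  let ?m = "edge_sqlen p0"
  have "algebraic_over (vals ?E ?m) (f ?m)"
  proof (rule ccontr)
    assume transc: "\<not> algebraic_over (vals ?E ?m) (f ?m)"
    have "derivation (vals ?E ?m) (\<lambda>x. 0)"
      by (simp add: derivation_def rat_subring_vals)
    from extend_derivation_transcendental[OF this transc]
    obtain K1 D1 where "derivation_extends (vals ?E ?m) (\<lambda>x. 0) K1 D1"
      and f1: "f ?m \<in> K1" "D1 (f ?m) = 1" by blast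
    then have 1: "derivation K1 D1" "vals ?E ?m \<subseteq> K1" "\<forall>x\<in>vals ?E ?m. D1 x = 0"
      by (auto simp: derivation_extends_def)
    have "finite (coords p0 ` (?V \<times> UNIV))" using finV by simp
    from extend_derivation[OF this 1(1)]
    obtain K D where "derivation_extends K1 D1 K D" and cK: "coords p0 ` (?V \<times> UNIV) \<subseteq> K"
      by blast
    then have D: "derivation K D" "K1 \<subseteq> K" "\<forall>x\<in>K1. D x = D1 x"
      by (auto simp: derivation_extends_def)
    have sub: "vals (?V \<times> UNIV) (coords p0) \<subseteq> K"
      using D(1) cK by (intro vals_subset) (auto simp: derivation_def)
    note dm = derivation_edge_sqlen[OF D(1) finV sub]
    have De: "D (?m e) = 0" if "e \<in> ?E" for e
      using vals_var[OF that, of ?m] 1 D by auto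
    have "D (?m {u, v}) = (\<Sum>x\<in>?V \<times> UNIV. edge_jacobian p0 {u, v} x * D (coords p0 x))"
      using dm(2)[of "{u, v}"] E' by blast
    also have "\<dots> = (\<Sum>x\<in>?V \<times> UNIV. \<Sum>e\<in>F. c e * (edge_jacobian p0 e x * D (coords p0 x)))"
      by (rule sum.cong[OF refl]) (simp add: row sum_distrib_right mult.assoc)
    also have "\<dots> = (\<Sum>e\<in>F. c e * (\<Sum>x\<in>?V \<times> UNIV. edge_jacobian p0 e x * D (coords p0 x)))"
      by (subst sum.swap) (simp add: sum_distrib_left)
    also have "\<dots> = (\<Sum>e\<in>F. c e * D (?m e))"
    proof (rule sum.cong[OF refl])
      fix e assume "e \<in> F"
      then have "e \<subseteq> ?V" "card e = 2" using F E'[of e] by auto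
      then show "c e * (\<Sum>x\<in>?V \<times> UNIV. edge_jacobian p0 e x * D (coords p0 x)) = c e * D (?m e)"
        by (simp only: dm(2))
    qed
    also have "\<dots> = 0" using De F by (intro sum.neutral) auto
    finally have "D (?m e) = 0" if "e \<in> ?E'" for e using De that by auto
    moreover have "D (f ?m) = (\<Sum>e\<in>?E'. partial_deriv e f ?m * D (?m e))"
      by (rule derivation_chain_rule[OF D(1) finE' _ f]) (use dm(1) E' in blast)
    ultimately have "D (f ?m) = 0" by simp
    then show False using f1 D(3) by simp
  qed
  then obtain P where P: "P \<in> polys_over (vals ?E ?m)" "P \<noteq> 0" "poly P (f ?m) = 0"
    by (auto simp: algebraic_over_def)
  obtain b where b: "\<And>i. b i \<in> ratpoly ?E" "\<And>i. b i ?m = coeff P i"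
    using poly_over_vals_lift[OF P(1)] by blast
  define h where "h y = (\<Sum>i\<le>degree P. b i y * f y ^ i)" for y
  have h: "h \<in> ratpoly ?E'"
    unfolding h_def
    by (intro ratpoly_sum ratpoly.mult ratpoly_power f ratpoly_mono[OF b(1)]) auto
  have "h ?m = 0" using P(3) by (simp add: h_def poly_altdef b(2))
  then have hp: "h (edge_sqlen p) = 0" using generic_edge_identity[OF p0 h E'] by blast
  define Q where "Q = (\<Sum>i\<le>degree P. monom (b i (edge_sqlen p)) i)"
  have Qi: "coeff Q i = (if i \<le> degree P then b i (edge_sqlen p) else 0)" for i
    by (simp add: Q_def coeff_sum)
  have "b (degree P) (edge_sqlen p) \<noteq> 0"
  proof
    assume "b (degree P) (edge_sqlen p) = 0"
    then have "b (degree P) ?m = 0"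
      using generic_edge_identity[OF p b(1)] E' by blast
    then show False using P(2) b(2) by simp
  qed
  then have "Q \<noteq> 0" using Qi[of "degree P"] by auto
  moreover have "Q \<in> polys_over (vals ?E (edge_sqlen p))"
    unfolding polys_over_def using Qi b(1) rat_subring_closed(2)[OF rat_subring_vals]
    by (auto simp: vals_def)
  moreover have "poly Q (f (edge_sqlen p)) = 0"
    using hp by (simp add: Q_def poly_sum poly_monom h_def)
  ultimately show ?thesis unfolding algebraic_over_def by blast
qed

text \<open>
  A relation that holds for \<open>p\<close> is an identity. Conversely, if the value at \<open>p\<close> is not \<open>0\<close>, it satisfies
  an algebraic equation over the edge lengths with nonzero constant term; the same equation holds for
  the value at \<open>q\<close>, and it rules out \<open>0\<close>.
\<close>

lemma linked_conjugate:
  fixes p q :: "'a \<Rightarrow> complex ^ 'd::finite"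
  assumes G: "is_graph G" and p: "generic (verts G) p" and linked: "rigidity_linked TYPE('d) G u v"
    and uv: "{u, v} \<notin> edges G" "{u, v} \<subseteq> verts G" "u \<noteq> v"
    and eq: "\<And>e. e \<in> edges G \<Longrightarrow> edge_sqlen q e = edge_sqlen p e"
    and f: "f \<in> ratpoly (insert {u, v} (edges G))"
  shows "f (edge_sqlen p) = 0 \<longleftrightarrow> f (edge_sqlen q) = 0"
proof -
  let ?E = "edges G" and ?E' = "insert {u, v} (edges G)"
  have E': "e \<subseteq> verts G \<and> card e = 2" if "e \<in> ?E'" for e
    using that G uv by (auto simp: is_graph_def)
  have fwd: "h (edge_sqlen q) = 0" if "h \<in> ratpoly ?E'" "h (edge_sqlen p) = 0" for h
    using generic_edge_identity[OF p that(1) E' that(2)] .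
  have "f (edge_sqlen p) = 0" if fq: "f (edge_sqlen q) = 0"
  proof (rule ccontr)
    assume nz: "f (edge_sqlen p) \<noteq> 0"
    have "\<exists>P\<in>polys_over (vals ?E (edge_sqlen p)). poly P (f (edge_sqlen p)) = 0 \<and> coeff P 0 \<noteq> 0"
      by (rule bexE[OF minimal_polynomial[OF rat_subring_vals linked_algebraic[OF G p linked uv f]]])
        (use nz in simp, rule bexI, auto)
    then obtain P where P: "P \<in> polys_over (vals ?E (edge_sqlen p))"
      and P0: "poly P (f (edge_sqlen p)) = 0 \<and> coeff P 0 \<noteq> 0" by (rule bexE)
    obtain h where h: "h \<in> ratpoly ?E'"
      "\<forall>y. (\<forall>e\<in>?E. y e = edge_sqlen p e) \<longrightarrow> h y = poly P (f y)"
      using lift_relation[OF P f subset_insertI] by (rule bexE)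
    have "h (edge_sqlen q) = 0" using fwd[OF h(1)] h(2) P0 by simp
    then have "poly P 0 = 0" using h(2)[rule_format, of "edge_sqlen q"] eq fq by simp
    then show False using P0 by (simp add: poly_0_coeff_0)
  qed
  then show ?thesis using fwd[OF f] by blast
qed

section \<open>Equilibrium stresses\<close>

text \<open>
  An arbitrary orientation of each edge, so that the signed incidences \<open>inc\<close> and the differences
  \<open>edge_diff\<close> along edges make sense. Everything they are used for is invariant under reversal.
\<close>

definition edge_ends :: "'a set \<Rightarrow> 'a \<times> 'a" where
  "edge_ends e = (SOME (a, b). e = {a, b} \<and> a \<noteq> b)"

definition inc :: "'a set \<Rightarrow> 'a \<Rightarrow> complex" where
  "inc e w = (if w = fst (edge_ends e) then 1 else if w = snd (edge_ends e) then -1 else 0)"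

definition edge_diff :: "('a \<Rightarrow> complex) \<Rightarrow> 'a set \<Rightarrow> complex" where
  "edge_diff g e = g (fst (edge_ends e)) - g (snd (edge_ends e))"

lemma edge_ends:
  assumes "card e = 2"
  shows "e = {fst (edge_ends e), snd (edge_ends e)}" "fst (edge_ends e) \<noteq> snd (edge_ends e)"
proof -
  have "\<exists>x. case x of (a, b) \<Rightarrow> e = {a, b} \<and> a \<noteq> b"
    using assms by (auto simp: card_2_iff)
  from someI_ex[OF this] show "e = {fst (edge_ends e), snd (edge_ends e)}"
    "fst (edge_ends e) \<noteq> snd (edge_ends e)"
    unfolding edge_ends_def by (auto simp: case_prod_unfold)
qed

lemma inc_outside: "card e = 2 \<Longrightarrow> w \<notin> e \<Longrightarrow> inc e w = 0"
  using edge_ends(1)[of e] by (auto simp: inc_def)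

lemma sum_inc:
  assumes "finite V" "e \<subseteq> V" "card e = 2"
  shows "(\<Sum>w\<in>V. inc e w * g w) = edge_diff g e"
proof -
  define a b where "a = fst (edge_ends e)" and "b = snd (edge_ends e)"
  have e: "e = {a, b}" "a \<noteq> b" using edge_ends[OF assms(3)] by (auto simp: a_def b_def)
  have "(\<Sum>w\<in>V. inc e w * g w) = (\<Sum>w\<in>e. inc e w * g w)"
    by (rule sum.mono_neutral_right) (use assms inc_outside in auto)
  also have "\<dots> = edge_diff g e"
    using e(2) unfolding edge_diff_def inc_def a_def[symmetric] b_def[symmetric]
    by (subst (1) e(1)) simp
  finally show ?thesis .
qed

lemma edge_sqlen_eq_sum_edge_diff:
  assumes "card e = 2"
  shows "edge_sqlen p e = (\<Sum>i\<in>UNIV. (edge_diff (\<lambda>w. p w $ i) e)\<^sup>2)"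
  using edge_sqlen_pair[of p "fst (edge_ends e)" "snd (edge_ends e)"] edge_ends(1)[OF assms]
  by (simp add: sqlen_def edge_diff_def)

lemma edge_jacobian_eq:
  assumes "card e = 2"
  shows "edge_jacobian p e (w, i) = 2 * inc e w * edge_diff (\<lambda>w. p w $ i) e"
proof -
  define a b where "a = fst (edge_ends e)" and "b = snd (edge_ends e)"
  have e: "a \<noteq> b" using edge_ends[OF assms] by (auto simp: a_def b_def)
  let ?x = "\<lambda>z. (coords p)((w, i) := z)"
  define \<delta> where "\<delta> y j = (if (y, j) = (w, i) then 1 else 0 :: complex)" for y j
  have d: "((\<lambda>z. ?x z (y, j)) has_field_derivative \<delta> y j) (at z)" for y j z
    by (cases "(y, j) = (w, i)") (auto simp: \<delta>_def)
  have "((\<lambda>z. \<Sum>j\<in>UNIV. (?x z (a, j) - ?x z (b, j))\<^sup>2) has_field_derivative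
      (\<Sum>j\<in>UNIV. 2 * (?x z (a, j) - ?x z (b, j)) * (\<delta> a j - \<delta> b j))) (at z)" for z
    by (auto intro!: derivative_eq_intros d sum.cong simp del: fun_upd_apply)
  note deriv = this[of "p w $ i"]
  have triv: "?x (p w $ i) = coords p"
    using fun_upd_triv[of "coords p" "(w, i)"] by (simp only: coords_apply)
  from deriv have "((\<lambda>z. \<Sum>j\<in>UNIV. (?x z (a, j) - ?x z (b, j))\<^sup>2) has_field_derivative
      (\<Sum>j\<in>UNIV. 2 * (p a $ j - p b $ j) * (\<delta> a j - \<delta> b j))) (at (coords p (w, i)))"
    unfolding coords_apply triv coords_apply .
  from DERIV_imp_deriv[OF this]
  have "edge_jacobian p e (w, i) = (\<Sum>j\<in>UNIV. 2 * (p a $ j - p b $ j) * (\<delta> a j - \<delta> b j))"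
    unfolding edge_jacobian_eq_pd partial_deriv_def edge_sqlen_eq_sum_edge_diff[OF assms] edge_diff_def
      config_of_nth a_def b_def .
  also have "\<dots> = (\<Sum>j\<in>UNIV. if j = i then 2 * inc e w * (p a $ i - p b $ i) else 0)"
    using e by (intro sum.cong refl) (auto simp: \<delta>_def inc_def a_def b_def)
  also have "\<dots> = 2 * inc e w * edge_diff (\<lambda>w. p w $ i) e"
    by (simp add: edge_diff_def a_def b_def)
  finally show ?thesis .
qed

text \<open>
  This is the stress matrix (the Laplacian with edge weights \<open>\<omega>\<close>) applied to \<open>g\<close>, evaluated at \<open>w\<close>. For
  \<open>g\<close> a coordinate of a framework it is a component of the total force that \<open>\<omega>\<close> exerts on \<open>w\<close>.
\<close>

definition stress_force :: "'a set set \<Rightarrow> ('a set \<Rightarrow> complex) \<Rightarrow> ('a \<Rightarrow> complex) \<Rightarrow> 'a \<Rightarrow> complex" where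
  "stress_force E \<omega> g w = (\<Sum>e\<in>E. \<omega> e * inc e w * edge_diff g e)"

lemma stress_energy:
  assumes "finite V" "\<And>e. e \<in> E \<Longrightarrow> e \<subseteq> V \<and> card e = 2"
  shows "(\<Sum>w\<in>V. f w * stress_force E \<omega> g w) = (\<Sum>e\<in>E. \<omega> e * edge_diff f e * edge_diff g e)"
proof -
  have "(\<Sum>w\<in>V. f w * stress_force E \<omega> g w)
      = (\<Sum>e\<in>E. \<omega> e * edge_diff g e * (\<Sum>w\<in>V. inc e w * f w))"
    unfolding stress_force_def sum_distrib_left
    by (subst sum.swap) (simp add: algebra_simps)
  also have "\<dots> = (\<Sum>e\<in>E. \<omega> e * edge_diff f e * edge_diff g e)"
    by (rule sum.cong[OF refl]) (use assms in \<open>simp add: sum_inc\<close>)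
  finally show ?thesis .
qed

lemma stress_force_sym:
  assumes "finite V" "\<And>e. e \<in> E \<Longrightarrow> e \<subseteq> V \<and> card e = 2"
  shows "(\<Sum>w\<in>V. f w * stress_force E \<omega> g w) = (\<Sum>w\<in>V. g w * stress_force E \<omega> f w)"
  by (simp add: stress_energy[OF assms] mult_ac)

lemma equilibrium_energy:
  fixes p :: "'a \<Rightarrow> complex ^ 'd::finite"
  assumes "finite V" "\<And>e. e \<in> E \<Longrightarrow> e \<subseteq> V \<and> card e = 2"
    and "\<And>w i. w \<in> V \<Longrightarrow> stress_force E \<omega> (\<lambda>w. p w $ i) w = 0"
  shows "(\<Sum>e\<in>E. \<omega> e * edge_sqlen p e) = 0"
proof -
  have "(\<Sum>e\<in>E. \<omega> e * edge_sqlen p e)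
      = (\<Sum>e\<in>E. \<Sum>i\<in>UNIV. \<omega> e * edge_diff (\<lambda>w. p w $ i) e * edge_diff (\<lambda>w. p w $ i) e)"
    by (rule sum.cong[OF refl])
      (use assms(2) in \<open>simp add: edge_sqlen_eq_sum_edge_diff sum_distrib_left power2_eq_square mult.assoc\<close>)
  also have "\<dots> = (\<Sum>i\<in>UNIV. \<Sum>w\<in>V. p w $ i * stress_force E \<omega> (\<lambda>w. p w $ i) w)"
    by (subst sum.swap) (simp add: stress_energy[OF assms(1,2)])
  also have "\<dots> = 0" using assms(3) by simp
  finally show ?thesis .
qed

lemma affine_span_equilibrium:
  assumes "g \<in> affine_span R I p" "\<And>i. stress_force E \<omega> (\<lambda>w. p w $ i) w = 0"
  shows "stress_force E \<omega> g w = 0"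
  using assms(1)
proof induction
  case (add g h)
  have "stress_force E \<omega> (\<lambda>y. g y + h y) w = stress_force E \<omega> g w + stress_force E \<omega> h w"
    unfolding stress_force_def sum.distrib[symmetric]
    by (rule sum.cong) (simp_all add: edge_diff_def algebra_simps)
  with add show ?case by simp
next
  case (scale c g)
  have "stress_force E \<omega> (\<lambda>y. c * g y) w = c * stress_force E \<omega> g w"
    by (simp add: stress_force_def edge_diff_def algebra_simps sum_distrib_left sum_subtractf)
  with scale show ?case by simp
next
  case (const c)
  then show ?case by (simp add: stress_force_def edge_diff_def)
qed (use assms(2) in simp)

text \<open>
  Pair \<open>f\<close> with \<open>t\<close> in the symmetric bilinear form of the stress. One way round the result is the
  force of \<open>f\<close> at \<open>k\<close>, the only place where neither \<open>t\<close> nor that force is known to vanish; the other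
  way round it is \<open>0\<close>.
\<close>

lemma equilibrium_from_interpolation:
  assumes V: "finite V" "\<And>e. e \<in> E \<Longrightarrow> e \<subseteq> V \<and> card e = 2"
    and free: "\<And>w. w \<in> V - K \<Longrightarrow> stress_force E \<omega> f w = 0"
    and k: "k \<in> K" "k \<in> V"
    and t: "\<And>w. w \<in> V \<Longrightarrow> stress_force E \<omega> t w = 0"
      "\<And>y. y \<in> K \<inter> V \<Longrightarrow> t y = (if y = k then 1 else 0)"
  shows "stress_force E \<omega> f k = 0"
proof -
  have "stress_force E \<omega> f k = (\<Sum>w\<in>V. if w = k then stress_force E \<omega> f w else 0)"
    using V(1) k by simp
  also have "\<dots> = (\<Sum>w\<in>V. t w * stress_force E \<omega> f w)"
  proof (rule sum.cong[OF refl])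
    fix w assume "w \<in> V"
    then show "(if w = k then stress_force E \<omega> f w else 0) = t w * stress_force E \<omega> f w"
      using free[of w] t(2)[of w] k by (cases "w \<in> K") auto
  qed
  also have "\<dots> = (\<Sum>w\<in>V. f w * stress_force E \<omega> t w)"
    by (rule stress_force_sym[OF V])
  also have "\<dots> = 0" using t(1) by simp
  finally show ?thesis .
qed

section \<open>The gluing theorem\<close>

text \<open>
  The argument explained at the beginning. Its steps are the facts \<open>conj\<close> (the two \<open>uv\<close>-lengths are
  conjugate), \<open>stress\<close> (\<open>\<omega>\<close> is a stress of \<open>p\<close>), \<open>outer\<close> and \<open>inner\<close> (\<open>\<omega>'\<close> is a stress of \<open>p\<close>).
\<close>

lemma linked_in_both_imp_sqlen_eq:
  fixes p q :: "'a \<Rightarrow> complex ^ 'd::finite"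
  assumes G1: "is_graph G1" and G2: "is_graph G2"
    and card: "card (verts G1 \<inter> verts G2) \<le> CARD('d) + 1"
    and u: "u \<in> verts G1 \<inter> verts G2" and v: "v \<in> verts G1 \<inter> verts G2" and "u \<noteq> v"
    and linked1: "rigidity_linked TYPE('d) G1 u v" and linked2: "rigidity_linked TYPE('d) G2 u v"
    and new: "{u, v} \<notin> edges G1" "{u, v} \<notin> edges G2"
    and p: "generic (verts G1 \<union> verts G2) p"
    and eq: "\<And>e. e \<in> edges G1 \<union> edges G2 \<Longrightarrow> edge_sqlen p e = edge_sqlen q e"
  shows "sqlen p u v = sqlen q u v"
proof -
  let ?V1 = "verts G1" and ?V2 = "verts G2" and ?V = "verts G1 \<union> verts G2"
  let ?E1 = "insert {u, v} (edges G1)" and ?E2 = "insert {u, v} (edges G2)"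
  let ?m = "edge_sqlen p" and ?m' = "edge_sqlen q"
  have fin: "finite ?V1" "finite ?V" using G1 G2 by (auto simp: is_graph_def)
  have p1: "generic ?V1 p" and p2: "generic ?V2 p" using generic_subset[OF p] by blast+
  have E1: "e \<subseteq> ?V1 \<and> card e = 2" if "e \<in> ?E1" for e
    using that G1 u v \<open>u \<noteq> v\<close> by (auto simp: is_graph_def)
  have E2: "e \<subseteq> ?V2 \<and> card e = 2" if "e \<in> ?E2" for e
    using that G2 u v \<open>u \<noteq> v\<close> by (auto simp: is_graph_def)
  have finE: "finite ?E1"
    using fin(1) E1 by (meson PowI finite_Pow_iff finite_subset subsetI)
  have uv1: "{u, v} \<subseteq> ?V1" and uv2: "{u, v} \<subseteq> ?V2" using u v by auto
  note alg1 = linked_algebraic[OF G1 p1 linked1 new(1) uv1 \<open>u \<noteq> v\<close>]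
  note alg2 = linked_algebraic[OF G2 p2 linked2 new(2) uv2 \<open>u \<noteq> v\<close>]
  have conj: "f ?m = 0 \<longleftrightarrow> f ?m' = 0" if "f \<in> ratpoly ?E1" for f
    by (rule linked_conjugate[OF G1 p1 linked1 new(1) uv1 \<open>u \<noteq> v\<close> _ that]) (use eq in auto)

  \<comment> \<open>\<open>h\<close> is the minimal equation of the \<open>uv\<close>-length with its coefficients turned into functions of the edge lengths.\<close>
  obtain P where P: "P \<in> polys_over (vals (edges G1) ?m)" "poly P (?m {u, v}) = 0"
    "poly (pderiv P) (?m {u, v}) \<noteq> 0"
    using minimal_polynomial[OF rat_subring_vals alg1[OF ratpoly.var[OF insertI1]]] by blast
  obtain h where h: "h \<in> ratpoly ?E1"
    "\<forall>y. (\<forall>e\<in>edges G1. y e = ?m e) \<longrightarrow> h y = poly P (y {u, v})"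
    using lift_relation[OF P(1) ratpoly.var[OF insertI1] subset_insertI] by (rule bexE)
  have hm: "h ?m = 0" using h(2) P(2) by simp
  then have hm': "h ?m' = 0" using conj[OF h(1)] by simp
  define \<omega> \<omega>' where "\<omega> e = partial_deriv e h ?m" and "\<omega>' e = partial_deriv e h ?m'" for e
  have "h (?m({u, v} := t)) = poly P t" for t
    using h(2)[rule_format, of "?m({u, v} := t)"] new(1) by fastforce
  then have "\<omega> {u, v} = poly (pderiv P) (?m {u, v})"
    by (simp add: \<omega>_def partial_deriv_def DERIV_imp_deriv[OF poly_DERIV])
  then have "\<omega> {u, v} \<noteq> 0" using P(3) by simp
  then have \<omega>'uv: "\<omega>' {u, v} \<noteq> 0"
    using conj[OF partial_deriv_ratpoly[OF h(1)]] by (simp add: \<omega>_def \<omega>'_def)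

  have stress: "stress_force ?E1 \<omega> (\<lambda>w. p w $ i) w = 0" if w: "w \<in> ?V1" for w i
  proof -
    obtain K D where D: "derivation K D" "vals (?V1 \<times> UNIV) (coords p) \<subseteq> K"
      "\<forall>j\<in>?V1 \<times> UNIV. D (coords p j) = (if j = (w, i) then 1 else 0)"
      "\<forall>x\<in>vals (?V1 \<times> UNIV - {(w, i)}) (coords p). D x = 0"
      by (rule coordinate_derivation[OF p1 SigmaI[OF w UNIV_I]])
    note dm = derivation_edge_sqlen[OF D(1) fin(1) D(2)]
    have c: "D (coords p j) = (if j = (w, i) then 1 else 0)" if "j \<in> ?V1 \<times> UNIV" for j
      using D(3) that by blast
    have "D (?m e) = edge_jacobian p e (w, i)" if "e \<in> ?E1" for e
    proof -
      have "D (?m e) = (\<Sum>j\<in>?V1 \<times> UNIV. if j = (w, i) then edge_jacobian p e j else 0)"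
        unfolding dm(2)[OF conjunct1[OF E1[OF that]] conjunct2[OF E1[OF that]]]
        by (rule sum.cong[OF refl]) (simp add: c)
      then show ?thesis using fin(1) w by simp
    qed
    then have "(\<Sum>e\<in>?E1. \<omega> e * edge_jacobian p e (w, i)) = (\<Sum>e\<in>?E1. partial_deriv e h ?m * D (?m e))"
      unfolding \<omega>_def by (intro sum.cong refl) simp
    also have "\<dots> = D (h ?m)"
      by (rule derivation_chain_rule[OF D(1) finE _ h(1), symmetric]) (use dm(1) E1 in blast)
    finally have "(\<Sum>e\<in>?E1. \<omega> e * edge_jacobian p e (w, i)) = 0"
      by (simp add: hm derivation_simps[OF D(1)])
    moreover have "(\<Sum>e\<in>?E1. \<omega> e * edge_jacobian p e (w, i)) = 2 * stress_force ?E1 \<omega> (\<lambda>w. p w $ i) w"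
      unfolding stress_force_def sum_distrib_left
      by (rule sum.cong[OF refl]) (use E1 in \<open>simp add: edge_jacobian_eq\<close>)
    ultimately show ?thesis by simp
  qed

  \<comment> \<open>Here the linkedness in \<open>G2\<close> enters: the \<open>uv\<close>-length of \<open>q\<close> does not depend on the vertices outside \<open>G2\<close>.\<close>
  have alg: "algebraic_over (vals (?V2 \<times> UNIV) (coords p)) (?m' {u, v})"
  proof -
    obtain Q where Q: "Q \<in> polys_over (vals (edges G2) ?m)" "Q \<noteq> 0" "poly Q (?m {u, v}) = 0"
      using alg2[OF ratpoly.var[OF insertI1]] by (auto simp: algebraic_over_def)
    obtain g where g: "g \<in> ratpoly ?E2"
      "\<forall>y. (\<forall>e\<in>edges G2. y e = ?m e) \<longrightarrow> g y = poly Q (y {u, v})"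
      using lift_relation[OF Q(1) ratpoly.var[OF insertI1] subset_insertI] by (rule bexE)
    have "g ?m' = 0"
      using generic_edge_identity[OF p2 g(1) E2] g(2) Q(3) by simp
    then have "poly Q (?m' {u, v}) = 0" using g(2)[rule_format, of ?m'] eq by simp
    with Q have "algebraic_over (vals (edges G2) ?m) (?m' {u, v})"
      by (auto simp: algebraic_over_def)
    moreover have "vals (edges G2) ?m \<subseteq> vals (?V2 \<times> UNIV) (coords p)"
    proof (rule vals_subset[OF rat_subring_vals])
      fix e assume "e \<in> edges G2"
      with E2 have "(\<lambda>x. edge_sqlen (config_of x) e) \<in> ratpoly (?V2 \<times> UNIV)"
        by (intro edge_sqlen_ratpoly) auto
      then have "edge_sqlen (config_of (coords p)) e \<in> vals (?V2 \<times> UNIV) (coords p)"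
        unfolding vals_def by (rule imageI)
      then show "?m e \<in> vals (?V2 \<times> UNIV) (coords p)" by simp
    qed
    ultimately show ?thesis by (rule algebraic_over_mono)
  qed

  have outer: "stress_force ?E1 \<omega>' (\<lambda>w. p w $ i) z = 0" if z: "z \<in> ?V1 - ?V2" for z i
  proof -
    obtain K0 D0 where D0: "derivation K0 D0" "vals (?V \<times> UNIV) (coords p) \<subseteq> K0"
      "\<forall>j\<in>?V \<times> UNIV. D0 (coords p j) = (if j = (z, i) then 1 else 0)"
      "\<forall>x\<in>vals (?V \<times> UNIV - {(z, i)}) (coords p). D0 x = 0"
      by (rule coordinate_derivation[OF p SigmaI[OF UnI1[OF DiffD1[OF z]] UNIV_I]])
    obtain K D where "derivation_extends K0 D0 K D" "{?m' {u, v}} \<subseteq> K"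
      using extend_derivation[OF finite.insertI[OF finite.emptyI] D0(1)] by blast
    then have D: "derivation K D" "K0 \<subseteq> K" "\<forall>x\<in>K0. D x = D0 x" and m'K: "?m' {u, v} \<in> K"
      by (auto simp: derivation_extends_def)
    have sub: "vals (?V \<times> UNIV) (coords p) \<subseteq> K" using D0(2) D(2) by blast
    note dm = derivation_edge_sqlen[OF D(1) fin(2) sub]
    have D0uv: "D (?m' {u, v}) = 0"
    proof (rule derivation_vanishes_on_algebraic[OF D(1) rat_subring_vals _ _ m'K alg])
      have V2: "vals (?V2 \<times> UNIV) (coords p) \<subseteq> vals (?V \<times> UNIV) (coords p)"
        "vals (?V2 \<times> UNIV) (coords p) \<subseteq> vals (?V \<times> UNIV - {(z, i)}) (coords p)"
        using z by (auto intro!: vals_mono)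
      show "vals (?V2 \<times> UNIV) (coords p) \<subseteq> K" using V2(1) sub by blast
      show "D x = 0" if x: "x \<in> vals (?V2 \<times> UNIV) (coords p)" for x
      proof -
        have "x \<in> K0" using x V2(1) D0(2) by blast
        then show ?thesis using D(3) D0(4) x V2(2) by (simp add: subset_iff)
      qed
    qed
    have De: "D (?m' e) = edge_jacobian p e (z, i)" if "e \<in> edges G1" for e
    proof -
      have e: "e \<subseteq> ?V" "card e = 2" using E1[of e] that by auto
      have c: "D (coords p j) = (if j = (z, i) then 1 else 0)" if "j \<in> ?V \<times> UNIV" for j
      proof -
        have "coords p j \<in> K0" using vals_var[OF that, of "coords p"] D0(2) by blast
        then have "D (coords p j) = D0 (coords p j)" using D(3) by blast
        then show ?thesis using bspec[OF D0(3) that] by (rule trans)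
      qed
      have "D (?m e) = (\<Sum>j\<in>?V \<times> UNIV. if j = (z, i) then edge_jacobian p e j else 0)"
        unfolding dm(2)[OF e] by (rule sum.cong[OF refl]) (simp add: c)
      then show ?thesis using fin z eq that by simp
    qed
    have J0: "edge_jacobian p {u, v} (z, i) = 0"
    proof -
      have "card {u, v} = 2" "z \<notin> {u, v}" using E1[of "{u, v}"] u v z by auto
      then show ?thesis by (simp add: edge_jacobian_eq inc_outside)
    qed
    have "D (h ?m') = (\<Sum>e\<in>?E1. partial_deriv e h ?m' * D (?m' e))"
    proof (rule derivation_chain_rule[OF D(1) finE _ h(1)])
      show "?m' e \<in> K" if "e \<in> ?E1" for e
      proof (cases "e = {u, v}")
        case False
        then have "e \<in> edges G1" using that by simp
        moreover have "?m e \<in> K" using dm(1)[of e] E1[OF that] by blast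
        ultimately show ?thesis using eq by simp
      qed (use m'K in simp)
    qed
    moreover have "(\<Sum>e\<in>edges G1. \<omega>' e * D (?m' e)) = (\<Sum>e\<in>edges G1. \<omega>' e * edge_jacobian p e (z, i))"
      by (rule sum.cong[OF refl]) (simp add: De)
    ultimately have "(\<Sum>e\<in>?E1. \<omega>' e * edge_jacobian p e (z, i)) = 0"
      using finE new(1) by (simp add: hm' derivation_simps[OF D(1)] \<omega>'_def D0uv J0)
    moreover have "(\<Sum>e\<in>?E1. \<omega>' e * edge_jacobian p e (z, i)) = 2 * stress_force ?E1 \<omega>' (\<lambda>w. p w $ i) z"
      unfolding stress_force_def sum_distrib_left
      by (rule sum.cong[OF refl]) (use E1 in \<open>simp add: edge_jacobian_eq\<close>)
    ultimately show ?thesis by simp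
  qed

  \<comment> \<open>The isomorphism that fixes the edge lengths of \<open>G1\<close> and exchanges the two conjugate \<open>uv\<close>-lengths.\<close>
  define T where "T = (\<lambda>f. (f ?m, f ?m')) ` ratpoly ?E1"
  have T: "(f ?m, f ?m') \<in> T" if "f \<in> ratpoly ?E1" for f
    unfolding T_def using that by blast
  interpret T: conjugate_pairs T
  proof
    show "(of_rat c, of_rat c) \<in> T" for c using T[OF ratpoly.const[of c]] .
    fix x x' y y' assume "(x, x') \<in> T"
    then obtain f where f: "f \<in> ratpoly ?E1" "x = f ?m" "x' = f ?m'" by (auto simp: T_def)
    then show "x = 0 \<longleftrightarrow> x' = 0" using conj by simp
    assume "(y, y') \<in> T"
    then obtain g where g: "g \<in> ratpoly ?E1" "y = g ?m" "y' = g ?m'" by (auto simp: T_def)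
    show "(x + y, x' + y') \<in> T" "(x * y, x' * y') \<in> T"
      using T[OF ratpoly.add[OF f(1) g(1)]] T[OF ratpoly.mult[OF f(1) g(1)]] f g by auto
  qed
  have T\<omega>: "(\<omega> e, \<omega>' e) \<in> T" for e
    unfolding \<omega>_def \<omega>'_def by (rule T[OF partial_deriv_ratpoly[OF h(1)]])
  have Tinc: "(inc e w, inc e w) \<in> T" for e w
    by (simp add: inc_def T.zero T.one T.uminus)

  have inner: "stress_force ?E1 \<omega>' (\<lambda>w. p w $ i) k = 0" if k: "k \<in> ?V1 \<inter> ?V2" for k i
  proof -
    obtain g where g: "g \<in> affine_span UNIV UNIV p"
      "\<forall>y\<in>?V1 \<inter> ?V2. g y = (if y = k then 1 else 0)"
      using generic_affine_interpolation[OF p _ _ card k] fin(1) by blast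
    obtain t where t: "\<forall>c0 c0' c c'. (c0, c0') \<in> T \<longrightarrow> (\<forall>v\<in>?V1. (c v, c' v) \<in> T) \<longrightarrow>
      c0 + (\<Sum>v\<in>?V1. c v * g v) = 0 \<longrightarrow> c0' + (\<Sum>v\<in>?V1. c' v * t v) = 0"
      using T.transfer_linear_solution[OF fin(1)] by (rule exE)
    \<comment> \<open>The force as an explicit linear form in \<open>s\<close>, so that equilibrium becomes a linear system with coefficients in the ring.\<close>
    have force: "stress_force ?E1 \<sigma> s w = (\<Sum>y\<in>?V1. (\<Sum>e\<in>?E1. \<sigma> e * inc e w * inc e y) * s y)"
      for \<sigma> s w
    proof -
      have "stress_force ?E1 \<sigma> s w = (\<Sum>e\<in>?E1. \<sigma> e * inc e w * (\<Sum>y\<in>?V1. inc e y * s y))"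
        unfolding stress_force_def
        by (rule sum.cong[OF refl]) (use E1 fin(1) in \<open>simp add: sum_inc\<close>)
      also have "\<dots> = (\<Sum>y\<in>?V1. (\<Sum>e\<in>?E1. \<sigma> e * inc e w * inc e y) * s y)"
        unfolding sum_distrib_left sum_distrib_right by (subst sum.swap) (simp add: mult.assoc)
      finally show ?thesis .
    qed
    have t_equilibrium: "stress_force ?E1 \<omega>' t w = 0" if w: "w \<in> ?V1" for w
    proof -
      have "stress_force ?E1 \<omega> g w = 0"
        by (rule affine_span_equilibrium[OF g(1)]) (rule stress[OF w])
      then have "0 + (\<Sum>y\<in>?V1. (\<Sum>e\<in>?E1. \<omega> e * inc e w * inc e y) * g y) = 0"
        unfolding force by simp
      from t[rule_format, OF T.zero _ this, of "\<lambda>y. \<Sum>e\<in>?E1. \<omega>' e * inc e w * inc e y"]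
      show ?thesis
        unfolding force by (simp add: T.sum T.mult T\<omega> Tinc del: sum.insert)
    qed
    have t_inner: "t y = (if y = k then 1 else 0)" if y: "y \<in> ?V1 \<inter> ?V2" for y
    proof -
      define \<delta> :: complex where "\<delta> = (if y = k then 1 else 0)"
      have "(- \<delta>, - \<delta>) \<in> T" by (simp add: \<delta>_def T.zero T.one T.uminus)
      moreover have "((if x = y then 1 else 0), (if x = y then 1 else 0)) \<in> T" for x
        by (simp add: T.zero T.one)
      moreover have pick: "(\<Sum>x\<in>?V1. (if x = y then 1 else 0) * s x) = s y" for s :: "'a \<Rightarrow> complex"
      proof -
        have "(\<Sum>x\<in>?V1. (if x = y then 1 else 0) * s x) = (\<Sum>x\<in>?V1. if x = y then s x else 0)"
          by (rule sum.cong) auto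
        then show ?thesis using y fin(1) by simp
      qed
      moreover have "- \<delta> + (\<Sum>x\<in>?V1. (if x = y then 1 else 0) * g x) = 0"
        unfolding pick using g(2) y by (simp add: \<delta>_def)
      ultimately have "- \<delta> + (\<Sum>x\<in>?V1. (if x = y then 1 else 0) * t x) = 0"
        by (intro t[rule_format, of "- \<delta>" "- \<delta>" "\<lambda>x. if x = y then 1 else 0" "\<lambda>x. if x = y then 1 else 0"]) auto
      then show ?thesis unfolding pick by (simp add: \<delta>_def)
    qed
    show ?thesis
    proof (rule equilibrium_from_interpolation[OF fin(1) E1])
      show "stress_force ?E1 \<omega>' (\<lambda>w. p w $ i) w = 0" if "w \<in> ?V1 - ?V2" for w
        by (rule outer[OF that])
      show "k \<in> ?V2" "k \<in> ?V1" using k by auto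
      show "stress_force ?E1 \<omega>' t w = 0" if "w \<in> ?V1" for w by (rule t_equilibrium[OF that])
      show "t y = (if y = k then 1 else 0)" if "y \<in> ?V2 \<inter> ?V1" for y
        using t_inner[of y] that by blast
    qed
  qed

  have "(\<Sum>e\<in>?E1. \<omega>' e * ?m e) = 0"
  proof (rule equilibrium_energy[OF fin(1) E1])
    show "stress_force ?E1 \<omega>' (\<lambda>w. p w $ i) w = 0" if "w \<in> ?V1" for w i
      by (cases "w \<in> ?V2") (use that outer[of w i] inner[of w i] in simp_all)
  qed
  moreover have "(\<Sum>e\<in>?E1. \<omega>' e * ?m' e) = 0"
  proof -
    have "(\<lambda>x. \<Sum>e\<in>?E1. partial_deriv e h x * x e) \<in> ratpoly ?E1"
      by (intro ratpoly_sum ratpoly.mult partial_deriv_ratpoly h ratpoly.var)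
    from conj[OF this] show ?thesis
      using equilibrium_energy[OF fin(1) E1, of ?E1 \<omega> p] stress by (simp add: \<omega>_def \<omega>'_def)
  qed
  moreover have "(\<Sum>e\<in>edges G1. \<omega>' e * ?m e) = (\<Sum>e\<in>edges G1. \<omega>' e * ?m' e)"
    by (rule sum.cong) (use eq in auto)
  ultimately have "\<omega>' {u, v} * ?m {u, v} + (\<Sum>e\<in>edges G1. \<omega>' e * ?m' e)
      = \<omega>' {u, v} * ?m' {u, v} + (\<Sum>e\<in>edges G1. \<omega>' e * ?m' e)"
    using finE new(1) by simp
  then have "\<omega>' {u, v} * ?m {u, v} = \<omega>' {u, v} * ?m' {u, v}"
    by (rule add_right_imp_eq)
  then show ?thesis using \<omega>'uv by (simp add: edge_sqlen_pair)
qed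

theorem theorem4p11:
  fixes G1 G2 :: "'a graph" and u v :: 'a
  assumes "is_graph G1" and "is_graph G2"
    and "card (verts G1 \<inter> verts G2) \<le> CARD('d::finite) + 1"
    and "u \<in> verts G1 \<inter> verts G2" and "v \<in> verts G1 \<inter> verts G2" and "u \<noteq> v"
    and "rigidity_linked TYPE('d) G1 u v"
    and "rigidity_linked TYPE('d) G2 u v"
  shows "globally_linked TYPE('d) (graph_union G1 G2) u v"
  unfolding globally_linked_def
proof (intro allI impI)
  fix p q :: "'a \<Rightarrow> real ^ 'd"
  assume "generic (verts (graph_union G1 G2)) p \<and>
    (\<forall>e\<in>edges (graph_union G1 G2). edge_sqlen p e = edge_sqlen q e)"
  then have p: "generic (verts G1 \<union> verts G2) p"
    and eq: "\<And>e. e \<in> edges G1 \<union> edges G2 \<Longrightarrow> edge_sqlen p e = edge_sqlen q e"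
    by (auto simp: graph_union_def)
  define cc :: "('a \<Rightarrow> real ^ 'd) \<Rightarrow> 'a \<Rightarrow> complex ^ 'd"
    where "cc r = (\<lambda>w. \<chi> i. complex_of_real (r w $ i))" for r
  have cc: "sqlen (cc r) a b = complex_of_real (sqlen r a b)" for r a b
    by (simp add: sqlen_def cc_def)
  show "sqlen p u v = sqlen q u v"
  proof (cases "{u, v} \<in> edges G1 \<union> edges G2")
    case True
    from eq[OF this] show ?thesis by (simp add: edge_sqlen_pair)
  next
    case False
    have "edge_sqlen (cc p) e = edge_sqlen (cc q) e" if e: "e \<in> edges G1 \<union> edges G2" for e
    proof -
      have "card e = 2" using e assms(1,2) by (auto simp: is_graph_def)
      then obtain a b where "e = {a, b}" by (auto simp: card_2_iff)
      then show ?thesis using eq[OF e] by (simp add: edge_sqlen_pair cc)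
    qed
    moreover have "generic (verts G1 \<union> verts G2) (cc p)"
      unfolding cc_def by (rule generic_of_real[OF p])
    ultimately have "sqlen (cc p) u v = sqlen (cc q) u v"
      using False by (intro linked_in_both_imp_sqlen_eq[OF assms]) auto
    then show ?thesis by (simp add: cc)
  qed
qed

end
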